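(* Let $w\in\mathbb{C}$ with $\mathrm{Re}(w)=1/2$, and put $\lambda_w=w(w-1)$. (1) If there is a solution $u\in H^1_\eta$ of $(T^\#_\eta-\lambda_w)u=\theta_\eta$, then $\theta_\eta(w)=0$. (2) If $\theta_\eta(w)=0$, then the solution $u$ of $(T^\#_\eta-\lambda_w)u=\theta_\eta$ lies in $H^1_\eta$ and equals $u_w$, where $u_w(s)=\frac{1+\eta c_s}{\lambda_s-\lambda_w}$ for $s\in1/2+i\mathbb{R}$ and $u_w(\tau_i)=\frac{\sqrt{\eta R_i}}{\lambda_{\sigma_i}-\lambda_w}$.
   Context: Let $h(s)$ be a meromorphic function with no zeros in $\mathrm{Re}(s)>1/2$ except for finitely many zeros $\sigma_1,\dots,\sigma_n\in(1/2,\infty)$ (largest $\sigma_n$), real-valued on $\mathbb{R}$, with $c_s:=h(1-s)/h(s)\ll|s|^{1-\epsilon}$ uniformly away from poles in $\mathrm{Re}(s)\ge 1/2$ for some $\epsilon>0$. Fix $\eta\in\{1,-1\}$, let $R_i=\mathrm{Res}_{s=\sigma_i}c_s$, and assume $\eta R_i\ge0$ for all $i$ and that $1+\eta c_s$ is not square-integrable on $1/2+i\mathbb{R}$. Let $S=\{\tau_1,\dots,\tau_n\}$ be abstract points in bijection with the $\sigma_i$; functions live on $(1/2+i\mathbb{R})\sqcup S$. Put $\lambda_s=s(s-1)$ on $1/2+i\mathbb{R}$, $\lambda_{\tau_i}=\lambda_{\sigma_i}=\sigma_i(\sigma_i-1)$, $\int_{(1/2)}g\,ds=\int_{1/2-i\infty}^{1/2+i\infty}g(s)\,ds$,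 and fix a real constant $c>0$ depending on the $\sigma_i$. For $k\in\mathbb{R}$, $H^k_\eta$ is the space of measurable $f$ on $(1/2+i\mathbb{R})\sqcup S$ with $(c-\lambda_s)^kf\in L^2(1/2+i\mathbb{R})\oplus L^2(S)$ and $f(1-s)=\eta f(s)/c_s$ for $\mathrm{Re}(s)=1/2$, with norm $\|f\|^2_{H^k_\eta}=\langle(c-\lambda_s)^kf,f\rangle_{L^2(1/2+i\mathbb{R})}+\langle(c-\lambda_{\sigma_i})^kf,f\rangle_{L^2(S)}$; in particular $\langle v,w\rangle_{H^1_\eta}=\frac{1}{4\pi i}\int_{(1/2)}(c-\lambda_s)v\overline{w}\,ds+\sum_i(c-\lambda_{\sigma_i})v(\tau_i)\overline{w(\tau_i)}$. $H^{-1}_\eta$ is the dual of $H^1_\eta$. $T^\#_\eta:H^1_\eta\to H^{-1}_\eta$ is defined by $((c-T^\#_\eta)v)(w)=\langle v,\overline w\rangle_{H^1_\eta}$; it acts as multiplication by $\lambda_s$ (resp. $\lambda_{\sigma_i}$ at $\tau_i$). Define $\theta_\eta(s)=1+\eta c_s$ for $s\in\mathbb{C}\setminus\{\sigma_1,\dots,\sigma_n\}$ and $\theta_\eta(\tau_i)=\sqrt{\eta R_i}$.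
   Formalization: In (2), for w = 1/2 it is also assumed that θ_η'(1/2) = 0, since for a simple zero there u_w is not in H^1_η; and H^k_η is read through its norm, i.e. (c−λ_s)^{k/2} f (not (c−λ_s)^k f) is in L². *)

theory Defs
  imports "HOL-Complex_Analysis.Complex_Analysis"
begin

text \<open>
  \<^term>\<open>h\<close> is taken to be nicely meromorphic, so it has value 0 at its poles.  The quotient
  below is a meromorphic function: points where \<^term>\<open>h\<close> has a zero or a pole may be removable
  singularities of it, in particular on the line \<open>Re s = 1/2\<close>, and are filled in.
\<close>

definition c_fun :: "(complex \<Rightarrow> complex) \<Rightarrow> complex \<Rightarrow> complex" where
  "c_fun h = remove_sings (\<lambda>s. h (1 - s) / h s)"

definition zeros_right :: "(complex \<Rightarrow> complex) \<Rightarrow> complex set" where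
  "zeros_right h = {s. Re s > 1/2 \<and> h s = 0 \<and> \<not> is_pole h s}"

definition c_growth :: "(complex \<Rightarrow> complex) \<Rightarrow> real \<Rightarrow> bool" where
  "c_growth h \<epsilon> \<longleftrightarrow>
     (\<forall>\<delta>>0. \<exists>C. \<forall>s. Re s \<ge> 1/2 \<and> (\<forall>p. is_pole (c_fun h) p \<longrightarrow> \<delta> \<le> dist s p) \<longrightarrow>
        cmod (c_fun h s) \<le> C * cmod s powr (1 - \<epsilon>))"

definition Res_c :: "(complex \<Rightarrow> complex) \<Rightarrow> (nat \<Rightarrow> real) \<Rightarrow> nat \<Rightarrow> complex" where
  "Res_c h \<sigma> i = residue (c_fun h) (of_real (\<sigma> i))"

definition lam :: "complex \<Rightarrow> complex" where
  "lam s = s * (s - 1)"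

definition crit :: "real \<Rightarrow> complex" where
  "crit t = Complex (1/2) t"

text \<open>Along \<open>s = 1/2 + i t\<close> one has \<open>ds = i dt\<close>.\<close>

definition crit_integral :: "(complex \<Rightarrow> complex) \<Rightarrow> complex" where
  "crit_integral g = \<i> * (\<integral>t. g (crit t) \<partial>lborel)"

definition L2_crit :: "(complex \<Rightarrow> complex) \<Rightarrow> bool" where
  "L2_crit g \<longleftrightarrow> (\<lambda>t. g (crit t)) \<in> borel_measurable lborel \<and>
                  integrable lborel (\<lambda>t. (cmod (g (crit t)))\<^sup>2)"

text \<open>
  Functions on the disjoint union of the line \<open>Re s = 1/2\<close> and \<open>S = {\<tau>\<^sub>1, \<dots>, \<tau>\<^sub>n}\<close> are functions
  on the following type, where \<^term>\<open>Inr i\<close> stands for \<open>\<tau>\<^sub>i\<close>.  Only the values at \<^term>\<open>Inl s\<close> with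
  \<open>Re s = 1/2\<close> and at \<^term>\<open>Inr i\<close> with \<open>1 \<le> i \<le> n\<close> matter; the values of \<open>\<theta>\<close> at other
  complex numbers are allowed for as well.
\<close>

type_synonym point = "complex + nat"

definition lam_at :: "(nat \<Rightarrow> real) \<Rightarrow> point \<Rightarrow> complex" where
  "lam_at \<sigma> = case_sum lam (\<lambda>i. lam (of_real (\<sigma> i)))"

definition inner_L2 :: "nat \<Rightarrow> (point \<Rightarrow> complex) \<Rightarrow> (point \<Rightarrow> complex) \<Rightarrow> complex" where
  "inner_L2 n v w = 1 / (4 * of_real pi * \<i>) * crit_integral (\<lambda>s. v (Inl s) * cnj (w (Inl s)))
                    + (\<Sum>i = 1..n. v (Inr i) * cnj (w (Inr i)))"

definition weight :: "(nat \<Rightarrow> real) \<Rightarrow> real \<Rightarrow> real \<Rightarrow> (point \<Rightarrow> complex) \<Rightarrow> point \<Rightarrow> complex" where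
  "weight \<sigma> c k f x = (of_real c - lam_at \<sigma> x) powr of_real k * f x"

definition inner_H ::
  "nat \<Rightarrow> (nat \<Rightarrow> real) \<Rightarrow> real \<Rightarrow> real \<Rightarrow> (point \<Rightarrow> complex) \<Rightarrow> (point \<Rightarrow> complex) \<Rightarrow> complex" where
  "inner_H n \<sigma> c k v w = inner_L2 n (weight \<sigma> c k v) w"

definition norm_H :: "nat \<Rightarrow> (nat \<Rightarrow> real) \<Rightarrow> real \<Rightarrow> real \<Rightarrow> (point \<Rightarrow> complex) \<Rightarrow> real" where
  "norm_H n \<sigma> c k f = sqrt (Re (inner_H n \<sigma> c k f f))"

text \<open>
  The squared norm \<open>\<langle>(c - \<lambda>)\<^sup>k f, f\<rangle>\<close> is finite iff \<open>(c - \<lambda>)\<^bsup>k/2\<^esup> f\<close> is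
  square-integrable; on the finite set \<open>S\<close> this is no condition.  Elements are representatives,
  to be identified by \<open>eq_H\<close> below.
\<close>

definition H_space ::
  "(complex \<Rightarrow> complex) \<Rightarrow> (nat \<Rightarrow> real) \<Rightarrow> real \<Rightarrow> real \<Rightarrow> real \<Rightarrow> (point \<Rightarrow> complex) set" where
  "H_space h \<sigma> \<eta> c k =
     {f. (\<lambda>t. f (Inl (crit t))) \<in> borel_measurable lborel \<and>
         L2_crit (\<lambda>s. weight \<sigma> c (k / 2) f (Inl s)) \<and>
         (AE t in lborel. f (Inl (1 - crit t)) = of_real \<eta> * f (Inl (crit t)) / c_fun h (crit t))}"

definition eq_H :: "nat \<Rightarrow> (point \<Rightarrow> complex) \<Rightarrow> (point \<Rightarrow> complex) \<Rightarrow> bool" where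
  "eq_H n u v \<longleftrightarrow> (AE t in lborel. u (Inl (crit t)) = v (Inl (crit t))) \<and>
                  (\<forall>i\<in>{1..n}. u (Inr i) = v (Inr i))"

definition H_dual ::
  "(complex \<Rightarrow> complex) \<Rightarrow> nat \<Rightarrow> (nat \<Rightarrow> real) \<Rightarrow> real \<Rightarrow> real \<Rightarrow> ((point \<Rightarrow> complex) \<Rightarrow> complex) set" where
  "H_dual h n \<sigma> \<eta> c =
     {F \<in> extensional (H_space h \<sigma> \<eta> c 1).
        (\<forall>f\<in>H_space h \<sigma> \<eta> c 1. \<forall>g\<in>H_space h \<sigma> \<eta> c 1. F (\<lambda>x. f x + g x) = F f + F g) \<and>
        (\<forall>a. \<forall>f\<in>H_space h \<sigma> \<eta> c 1. F (\<lambda>x. a * f x) = a * F f) \<and>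
        (\<exists>K. \<forall>f\<in>H_space h \<sigma> \<eta> c 1. cmod (F f) \<le> K * norm_H n \<sigma> c 1 f)}"

text \<open>
  A function \<open>g\<close> acts on \<open>H\<^sup>1\<close> by \<open>f \<mapsto> \<langle>g, cnj f\<rangle>\<close> in \<open>L\<^sup>2\<close>; this is the inclusion of
  \<open>H\<^sup>1\<close> (and of \<open>\<theta>\<close>) in the dual under which \<open>T\<^sup>#\<close> is multiplication by \<open>\<lambda>\<close>.
\<close>

definition to_dual ::
  "(complex \<Rightarrow> complex) \<Rightarrow> nat \<Rightarrow> (nat \<Rightarrow> real) \<Rightarrow> real \<Rightarrow> real \<Rightarrow> (point \<Rightarrow> complex) \<Rightarrow>
     (point \<Rightarrow> complex) \<Rightarrow> complex" where
  "to_dual h n \<sigma> \<eta> c g = (\<lambda>f\<in>H_space h \<sigma> \<eta> c 1. inner_L2 n g (\<lambda>x. cnj (f x)))"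

text \<open>Solved for \<open>T\<^sup># v\<close> from \<open>((c - T\<^sup>#) v)(f) = \<langle>v, cnj f\<rangle>\<close> in \<open>H\<^sup>1\<close>.\<close>

definition T_sharp ::
  "(complex \<Rightarrow> complex) \<Rightarrow> nat \<Rightarrow> (nat \<Rightarrow> real) \<Rightarrow> real \<Rightarrow> real \<Rightarrow> (point \<Rightarrow> complex) \<Rightarrow>
     (point \<Rightarrow> complex) \<Rightarrow> complex" where
  "T_sharp h n \<sigma> \<eta> c v =
     (\<lambda>f\<in>H_space h \<sigma> \<eta> c 1.
        of_real c * to_dual h n \<sigma> \<eta> c v f - inner_H n \<sigma> c 1 v (\<lambda>x. cnj (f x)))"

definition theta :: "(complex \<Rightarrow> complex) \<Rightarrow> (nat \<Rightarrow> real) \<Rightarrow> real \<Rightarrow> point \<Rightarrow> complex" where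
  "theta h \<sigma> \<eta> = case_sum (\<lambda>s. 1 + of_real \<eta> * c_fun h s)
                          (\<lambda>i. csqrt (of_real \<eta> * Res_c h \<sigma> i))"

definition u_sol :: "(complex \<Rightarrow> complex) \<Rightarrow> (nat \<Rightarrow> real) \<Rightarrow> real \<Rightarrow> complex \<Rightarrow> point \<Rightarrow> complex" where
  "u_sol h \<sigma> \<eta> w =
     case_sum (\<lambda>s. (1 + of_real \<eta> * c_fun h s) / (lam s - lam w))
              (\<lambda>i. csqrt (of_real \<eta> * Res_c h \<sigma> i) / (lam (of_real (\<sigma> i)) - lam w))"

text \<open>The equation \<open>(T\<^sup># - \<lambda>\<^sub>w) u = \<theta>\<close> in the dual of \<open>H\<^sup>1\<close>.\<close>

definition solves ::
  "(complex \<Rightarrow> complex) \<Rightarrow> nat \<Rightarrow> (nat \<Rightarrow> real) \<Rightarrow> real \<Rightarrow> real \<Rightarrow> complex \<Rightarrow> (point \<Rightarrow> complex) \<Rightarrow> bool" where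
  "solves h n \<sigma> \<eta> c w u \<longleftrightarrow>
     (\<lambda>f\<in>H_space h \<sigma> \<eta> c 1. T_sharp h n \<sigma> \<eta> c u f - lam w * to_dual h n \<sigma> \<eta> c u f)
       = to_dual h n \<sigma> \<eta> c (theta h \<sigma> \<eta>)"

lemma c_minus_lam_crit: "of_real c - lam (crit t) = of_real (c + 1/4 + t\<^sup>2)"
  by (simp add: lam_def crit_def complex_eq_iff power2_eq_square)

lemma H1_line:
  assumes "f \<in> H_space h \<sigma> \<eta> c 1" and "c > 0"
  shows "(\<lambda>t. f (Inl (crit t))) \<in> borel_measurable lborel"
    and "integrable lborel (\<lambda>t. (c + 1/4 + t\<^sup>2) * (cmod (f (Inl (crit t))))\<^sup>2)"
proof -
  show "(\<lambda>t. f (Inl (crit t))) \<in> borel_measurable lborel"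
    using assms(1) by (simp add: H_space_def)
  have "(cmod (weight \<sigma> c (1/2) f (Inl (crit t))))\<^sup>2
          = (c + 1/4 + t\<^sup>2) * (cmod (f (Inl (crit t))))\<^sup>2" for t
  proof -
    have p: "c + 1/4 + t\<^sup>2 > 0"
      using assms(2) zero_le_power2[of t] by linarith
    have "cmod (of_real (c + 1/4 + t\<^sup>2) powr of_real (1/2)) = (c + 1/4 + t\<^sup>2) powr (1/2)"
      using p by (subst norm_powr_real_powr) (auto simp del: of_real_add of_real_power)
    moreover have "((c + 1/4 + t\<^sup>2) powr (1/2))\<^sup>2 = c + 1/4 + t\<^sup>2"
      using p by (simp add: powr_half_sqrt)
    ultimately show ?thesis
      by (simp add: weight_def lam_at_def c_minus_lam_crit norm_mult power_mult_distrib
           del: of_real_add of_real_power)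
  qed
  then show "integrable lborel (\<lambda>t. (c + 1/4 + t\<^sup>2) * (cmod (f (Inl (crit t))))\<^sup>2)"
    using assms(1) by (simp add: H_space_def L2_crit_def)
qed

lemma H1_integrable:
  assumes v: "v \<in> H_space h \<sigma> \<eta> c 1" and f: "f \<in> H_space h \<sigma> \<eta> c 1" and c: "c > 0"
    and m: "continuous_on UNIV m" and mK: "\<And>t. \<bar>m t\<bar> \<le> c + 1/4 + t\<^sup>2"
  shows "integrable lborel (\<lambda>t. of_real (m t) * v (Inl (crit t)) * f (Inl (crit t)))"
    and "cmod (\<integral>t. of_real (m t) * v (Inl (crit t)) * f (Inl (crit t)) \<partial>lborel)
           \<le> (\<integral>t. (c + 1/4 + t\<^sup>2) * (cmod (v (Inl (crit t))))\<^sup>2 \<partial>lborel)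
             + (\<integral>t. (c + 1/4 + t\<^sup>2) * (cmod (f (Inl (crit t))))\<^sup>2 \<partial>lborel)"
proof -
  let ?W = "\<lambda>t::real. c + 1/4 + t\<^sup>2"
  let ?v = "\<lambda>t. v (Inl (crit t))" and ?f = "\<lambda>t. f (Inl (crit t))"
  have [measurable]: "?v \<in> borel_measurable borel" "?f \<in> borel_measurable borel"
    using H1_line(1)[OF v c] H1_line(1)[OF f c] by simp_all
  have [measurable]: "m \<in> borel_measurable borel"
    using m by (rule borel_measurable_continuous_onI)
  have I: "integrable lborel (\<lambda>t. ?W t * (cmod (?v t))\<^sup>2)" "integrable lborel (\<lambda>t. ?W t * (cmod (?f t))\<^sup>2)"
    using H1_line(2)[OF v c] H1_line(2)[OF f c] by simp_all
  have S: "integrable lborel (\<lambda>t. ?W t * (cmod (?v t))\<^sup>2 + ?W t * (cmod (?f t))\<^sup>2)"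
    by (rule Bochner_Integration.integrable_add[OF I])
  have B: "cmod (of_real (m t) * ?v t * ?f t) \<le> ?W t * (cmod (?v t))\<^sup>2 + ?W t * (cmod (?f t))\<^sup>2" for t
  proof -
    have "0 \<le> (cmod (?v t) - cmod (?f t))\<^sup>2" "0 \<le> (cmod (?v t))\<^sup>2" "0 \<le> (cmod (?f t))\<^sup>2"
      by simp_all
    then have p: "cmod (?v t) * cmod (?f t) \<le> (cmod (?v t))\<^sup>2 + (cmod (?f t))\<^sup>2"
      unfolding power2_diff by linarith
    have "cmod (of_real (m t) * ?v t * ?f t) = \<bar>m t\<bar> * (cmod (?v t) * cmod (?f t))"
      by (simp add: norm_mult)
    also have "\<dots> \<le> ?W t * ((cmod (?v t))\<^sup>2 + (cmod (?f t))\<^sup>2)"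
      using p mK[of t] by (intro mult_mono) auto
    finally show ?thesis by (simp add: distrib_left)
  qed
  show J: "integrable lborel (\<lambda>t. of_real (m t) * ?v t * ?f t)"
  proof (rule Bochner_Integration.integrable_bound[OF S])
    show "(\<lambda>t. of_real (m t) * ?v t * ?f t) \<in> borel_measurable lborel" by simp
    show "AE t in lborel. cmod (of_real (m t) * ?v t * ?f t)
            \<le> norm (?W t * (cmod (?v t))\<^sup>2 + ?W t * (cmod (?f t))\<^sup>2)"
    proof (rule AE_I2)
      fix t show "cmod (of_real (m t) * ?v t * ?f t)
            \<le> norm (?W t * (cmod (?v t))\<^sup>2 + ?W t * (cmod (?f t))\<^sup>2)"
        unfolding real_norm_def by (rule order_trans[OF B abs_ge_self])
    qed
  qed
  have "cmod (\<integral>t. of_real (m t) * ?v t * ?f t \<partial>lborel)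
          \<le> (\<integral>t. cmod (of_real (m t) * ?v t * ?f t) \<partial>lborel)"
    by (rule integral_norm_bound)
  also have "\<dots> \<le> (\<integral>t. ?W t * (cmod (?v t))\<^sup>2 + ?W t * (cmod (?f t))\<^sup>2 \<partial>lborel)"
    by (rule integral_mono[OF integrable_norm[OF J] S B])
  finally show "cmod (\<integral>t. of_real (m t) * ?v t * ?f t \<partial>lborel)
      \<le> (\<integral>t. ?W t * (cmod (?v t))\<^sup>2 \<partial>lborel) + (\<integral>t. ?W t * (cmod (?f t))\<^sup>2 \<partial>lborel)"
    by (simp only: Bochner_Integration.integral_add[OF I])
qed

lemma inner_L2_mult:
  assumes "\<And>t. g (Inl (crit t)) = of_real (m t)"
  shows "inner_L2 n (\<lambda>x. g x * v x) (\<lambda>x. cnj (f x)) =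
           (\<integral>t. of_real (m t) * v (Inl (crit t)) * f (Inl (crit t)) \<partial>lborel) / of_real (4 * pi)
           + (\<Sum>i = 1..n. g (Inr i) * v (Inr i) * f (Inr i))"
  using assms by (simp add: inner_L2_def crit_integral_def)

lemma T_sharp_mult:
  assumes v: "v \<in> H_space h \<sigma> \<eta> c 1" and f: "f \<in> H_space h \<sigma> \<eta> c 1" and c: "c > 0"
  shows "T_sharp h n \<sigma> \<eta> c v f = inner_L2 n (\<lambda>x. lam_at \<sigma> x * v x) (\<lambda>x. cnj (f x))"
proof -
  let ?P = "\<lambda>m::real \<Rightarrow> real. \<lambda>t. of_real (m t) * v (Inl (crit t)) * f (Inl (crit t))"
  have W: "weight \<sigma> c 1 v = (\<lambda>x. (of_real c - lam_at \<sigma> x) * v x)"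
    by (auto simp: weight_def fun_eq_iff)
  have lam: "lam (crit t) = of_real (- 1/4 - t\<^sup>2)" for t
    by (simp add: lam_def crit_def complex_eq_iff power2_eq_square)
  have I1: "integrable lborel (?P (\<lambda>t. c))"
    by (rule H1_integrable(1)[OF v f c]) (use c in \<open>auto\<close>)
  have I2: "integrable lborel (?P (\<lambda>t. c + 1/4 + t\<^sup>2))"
    by (rule H1_integrable(1)[OF v f c]) (use c in \<open>auto intro!: continuous_intros\<close>)
  have A: "of_real c * inner_L2 n v (\<lambda>x. cnj (f x)) =
      (\<integral>t. ?P (\<lambda>t. c) t \<partial>lborel) / of_real (4 * pi) + (\<Sum>i = 1..n. of_real c * v (Inr i) * f (Inr i))"
    using inner_L2_mult[of "\<lambda>x. 1" "\<lambda>t. 1" n v f]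
    by (simp add: distrib_left sum_distrib_left mult.assoc)
  have B: "inner_H n \<sigma> c 1 v (\<lambda>x. cnj (f x)) =
      (\<integral>t. ?P (\<lambda>t. c + 1/4 + t\<^sup>2) t \<partial>lborel) / of_real (4 * pi)
      + (\<Sum>i = 1..n. (of_real c - lam_at \<sigma> (Inr i)) * v (Inr i) * f (Inr i))"
    unfolding inner_H_def W
    by (rule inner_L2_mult) (simp add: lam_at_def c_minus_lam_crit)
  have C: "inner_L2 n (\<lambda>x. lam_at \<sigma> x * v x) (\<lambda>x. cnj (f x)) =
      (\<integral>t. ?P (\<lambda>t. - 1/4 - t\<^sup>2) t \<partial>lborel) / of_real (4 * pi)
      + (\<Sum>i = 1..n. lam_at \<sigma> (Inr i) * v (Inr i) * f (Inr i))"
    by (rule inner_L2_mult) (simp add: lam_at_def lam)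
  have D: "(\<integral>t. ?P (\<lambda>t. c) t \<partial>lborel) - (\<integral>t. ?P (\<lambda>t. c + 1/4 + t\<^sup>2) t \<partial>lborel)
             = (\<integral>t. ?P (\<lambda>t. - 1/4 - t\<^sup>2) t \<partial>lborel)"
    unfolding Bochner_Integration.integral_diff[OF I1 I2, symmetric]
    by (rule Bochner_Integration.integral_cong) (auto simp: algebra_simps)
  have "T_sharp h n \<sigma> \<eta> c v f
          = of_real c * inner_L2 n v (\<lambda>x. cnj (f x)) - inner_H n \<sigma> c 1 v (\<lambda>x. cnj (f x))"
    using f by (simp add: T_sharp_def to_dual_def)
  also have "\<dots> = inner_L2 n (\<lambda>x. lam_at \<sigma> x * v x) (\<lambda>x. cnj (f x))"
    unfolding A B C D[symmetric]
    by (simp add: diff_divide_distrib sum_subtractf algebra_simps)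
  finally show ?thesis .
qed

lemma H1_add:
  assumes f: "f \<in> H_space h \<sigma> \<eta> c 1" and g: "g \<in> H_space h \<sigma> \<eta> c 1" and c: "c > 0"
  shows "(\<lambda>x. f x + g x) \<in> H_space h \<sigma> \<eta> c 1"
proof -
  let ?a = "\<lambda>t. weight \<sigma> c (1/2) f (Inl (crit t))" and ?b = "\<lambda>t. weight \<sigma> c (1/2) g (Inl (crit t))"
  have [measurable]: "?a \<in> borel_measurable lborel" "?b \<in> borel_measurable lborel"
    and I: "integrable lborel (\<lambda>t. (cmod (?a t))\<^sup>2)" "integrable lborel (\<lambda>t. (cmod (?b t))\<^sup>2)"
    using f g by (auto simp: H_space_def L2_crit_def)
  have w: "weight \<sigma> c (1/2) (\<lambda>x. f x + g x) = (\<lambda>x. weight \<sigma> c (1/2) f x + weight \<sigma> c (1/2) g x)"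
    by (auto simp: weight_def fun_eq_iff distrib_left)
  have "integrable lborel (\<lambda>t. (cmod (?a t + ?b t))\<^sup>2)"
  proof (rule Bochner_Integration.integrable_bound)
    show "integrable lborel (\<lambda>t. 2 * (cmod (?a t))\<^sup>2 + 2 * (cmod (?b t))\<^sup>2)"
      using I by simp
    show "AE t in lborel. norm ((cmod (?a t + ?b t))\<^sup>2) \<le> norm (2 * (cmod (?a t))\<^sup>2 + 2 * (cmod (?b t))\<^sup>2)"
    proof (rule AE_I2)
      fix t
      have "(cmod (?a t + ?b t))\<^sup>2 \<le> (cmod (?a t) + cmod (?b t))\<^sup>2"
        by (intro power_mono norm_triangle_ineq) auto
      also have "\<dots> \<le> 2 * (cmod (?a t))\<^sup>2 + 2 * (cmod (?b t))\<^sup>2"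
        using zero_le_power2[of "cmod (?a t) - cmod (?b t)"]
        unfolding power2_diff power2_sum by linarith
      finally show "norm ((cmod (?a t + ?b t))\<^sup>2) \<le> norm (2 * (cmod (?a t))\<^sup>2 + 2 * (cmod (?b t))\<^sup>2)"
        by simp
    qed
  qed simp
  then have "L2_crit (\<lambda>s. weight \<sigma> c (1/2) (\<lambda>x. f x + g x) (Inl s))"
    unfolding w L2_crit_def by simp
  moreover have "AE t in lborel. f (Inl (1 - crit t)) + g (Inl (1 - crit t))
      = of_real \<eta> * (f (Inl (crit t)) + g (Inl (crit t))) / c_fun h (crit t)"
  proof -
    have "AE t in lborel. f (Inl (1 - crit t)) = of_real \<eta> * f (Inl (crit t)) / c_fun h (crit t)"
      "AE t in lborel. g (Inl (1 - crit t)) = of_real \<eta> * g (Inl (crit t)) / c_fun h (crit t)"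
      using f g by (simp_all add: H_space_def)
    then show ?thesis
      by eventually_elim (simp add: distrib_left add_divide_distrib)
  qed
  ultimately show ?thesis
    using f g by (auto simp: H_space_def)
qed

lemma H1_scale:
  assumes f: "f \<in> H_space h \<sigma> \<eta> c 1"
  shows "(\<lambda>x. a * f x) \<in> H_space h \<sigma> \<eta> c 1"
proof -
  have w: "weight \<sigma> c (1/2) (\<lambda>x. a * f x) = (\<lambda>x. a * weight \<sigma> c (1/2) f x)"
    by (auto simp: weight_def fun_eq_iff)
  have "AE t in lborel. a * f (Inl (1 - crit t))
      = of_real \<eta> * (a * f (Inl (crit t))) / c_fun h (crit t)"
  proof -
    have "AE t in lborel. f (Inl (1 - crit t)) = of_real \<eta> * f (Inl (crit t)) / c_fun h (crit t)"
      using f by (simp add: H_space_def)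
    then show ?thesis
      by eventually_elim simp
  qed
  then show ?thesis
    using f by (auto simp: H_space_def L2_crit_def w norm_mult power_mult_distrib)
qed

lemma norm_H_sq:
  assumes f: "f \<in> H_space h \<sigma> \<eta> c 1" and c: "c > 0"
  shows "Re (inner_H n \<sigma> c 1 f f) =
     (\<integral>t. (c + 1/4 + t\<^sup>2) * (cmod (f (Inl (crit t))))\<^sup>2 \<partial>lborel) / (4 * pi)
     + (\<Sum>i = 1..n. (c - \<sigma> i * (\<sigma> i - 1)) * (cmod (f (Inr i)))\<^sup>2)"
proof -
  have z: "z * cnj z = of_real ((cmod z)\<^sup>2)" for z
    by (rule complex_norm_square[symmetric])
  have "inner_H n \<sigma> c 1 f f = 
     (\<integral>t. of_real ((c + 1/4 + t\<^sup>2) * (cmod (f (Inl (crit t))))\<^sup>2) \<partial>lborel) / of_real (4 * pi)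
     + (\<Sum>i = 1..n. of_real ((c - \<sigma> i * (\<sigma> i - 1)) * (cmod (f (Inr i)))\<^sup>2))"
    unfolding inner_H_def inner_L2_def crit_integral_def weight_def
    by (simp add: mult.assoc z lam_at_def c_minus_lam_crit del: of_real_add of_real_power)
       (simp add: lam_def)
  also have "\<dots> = of_real ((\<integral>t. (c + 1/4 + t\<^sup>2) * (cmod (f (Inl (crit t))))\<^sup>2 \<partial>lborel) / (4 * pi)
     + (\<Sum>i = 1..n. (c - \<sigma> i * (\<sigma> i - 1)) * (cmod (f (Inr i)))\<^sup>2))"
    by (simp only: integral_complex_of_real of_real_add of_real_divide of_real_sum)
  finally show ?thesis by simp
qed

lemma T_sharp_in_dual:
  assumes v: "v \<in> H_space h \<sigma> \<eta> c 1" and c: "c > 0"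
    and pos: "\<And>i. i \<in> {1..n} \<Longrightarrow> \<sigma> i * (\<sigma> i - 1) < c"
  shows "T_sharp h n \<sigma> \<eta> c v \<in> H_dual h n \<sigma> \<eta> c"
proof -
  let ?H = "H_space h \<sigma> \<eta> c 1" and ?F = "T_sharp h n \<sigma> \<eta> c v"
  let ?W = "\<lambda>t::real. c + 1/4 + t\<^sup>2"
  let ?m = "\<lambda>t::real. - 1/4 - t\<^sup>2"
  let ?l = "\<lambda>i. \<sigma> i * (\<sigma> i - 1)"
  let ?I = "\<lambda>f. (\<integral>t. of_real (?m t) * v (Inl (crit t)) * f (Inl (crit t)) \<partial>lborel)"
  define N where "N f = Re (inner_H n \<sigma> c 1 f f)" for f
  have lam: "lam (crit t) = of_real (?m t)" for t
    by (simp add: lam_def crit_def complex_eq_iff power2_eq_square)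
  have F: "?F f = ?I f / of_real (4 * pi) + (\<Sum>i = 1..n. of_real (?l i) * v (Inr i) * f (Inr i))"
    if "f \<in> ?H" for f
    unfolding T_sharp_mult[OF v that c]
    by (subst inner_L2_mult[where m = ?m]) (simp add: lam_at_def lam, simp add: lam_at_def lam_def)
  have mW: "\<bar>?m t\<bar> \<le> ?W t" for t
    using c zero_le_power2[of t] by linarith
  have mc: "continuous_on UNIV ?m" by (intro continuous_intros)
  note int = H1_integrable[OF v _ c mc mW]
  have add: "?F (\<lambda>x. f x + g x) = ?F f + ?F g" if "f \<in> ?H" "g \<in> ?H" for f g
  proof -
    have "?I (\<lambda>x. f x + g x) = ?I f + ?I g"
      using Bochner_Integration.integral_add[OF int(1)[OF that(1)] int(1)[OF that(2)]]
      by (simp add: distrib_left)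
    then show ?thesis
      by (simp only: F[OF that(1)] F[OF that(2)] F[OF H1_add[OF that c]])
         (simp add: add_divide_distrib distrib_left sum.distrib)
  qed
  have scale: "?F (\<lambda>x. a * f x) = a * ?F f" if "f \<in> ?H" for f a
  proof -
    have "?I (\<lambda>x. a * f x) = (\<integral>t. a * (of_real (?m t) * v (Inl (crit t)) * f (Inl (crit t))) \<partial>lborel)"
      by (rule Bochner_Integration.integral_cong) auto
    then have "?I (\<lambda>x. a * f x) = a * ?I f" by simp
    then show ?thesis
      by (simp only: F[OF that] F[OF H1_scale[OF that]])
         (simp add: distrib_left sum_distrib_left mult_ac)
  qed
  define K where "K = 1 + (\<Sum>i = 1..n. \<bar>?l i\<bar> / (c - ?l i))"
  have K1: "K \<ge> 1"
    unfolding K_def using pos by (auto intro!: sum_nonneg divide_nonneg_nonneg simp: less_imp_le)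
  have Ki: "\<bar>?l i\<bar> \<le> K * (c - ?l i)" if "i \<in> {1..n}" for i
  proof -
    have "\<bar>?l i\<bar> / (c - ?l i) \<le> (\<Sum>i = 1..n. \<bar>?l i\<bar> / (c - ?l i))"
      using that pos by (intro member_le_sum) (auto intro!: divide_nonneg_nonneg simp: less_imp_le)
    then have "\<bar>?l i\<bar> / (c - ?l i) \<le> K" by (simp add: K_def)
    then show ?thesis using pos[OF that] by (simp add: pos_divide_le_eq)
  qed
  have N: "N f = (\<integral>t. ?W t * (cmod (f (Inl (crit t))))\<^sup>2 \<partial>lborel) / (4 * pi)
             + (\<Sum>i = 1..n. (c - ?l i) * (cmod (f (Inr i)))\<^sup>2)" if "f \<in> ?H" for f
    unfolding N_def by (rule norm_H_sq[OF that c])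
  have N0: "N f \<ge> 0" if "f \<in> ?H" for f
    unfolding N[OF that] using c pos
    by (intro add_nonneg_nonneg divide_nonneg_nonneg sum_nonneg mult_nonneg_nonneg integral_nonneg_AE)
       (auto simp: less_imp_le)
  have Nscale: "N (\<lambda>x. of_real r * f x) = r\<^sup>2 * N f" if "f \<in> ?H" for f r
  proof -
    have "(\<integral>t. ?W t * (cmod (of_real r * f (Inl (crit t))))\<^sup>2 \<partial>lborel)
            = (\<integral>t. r\<^sup>2 * (?W t * (cmod (f (Inl (crit t))))\<^sup>2) \<partial>lborel)"
      by (rule Bochner_Integration.integral_cong) (auto simp: norm_mult power_mult_distrib)
    then have 1: "(\<integral>t. ?W t * (cmod (of_real r * f (Inl (crit t))))\<^sup>2 \<partial>lborel)
            = r\<^sup>2 * (\<integral>t. ?W t * (cmod (f (Inl (crit t))))\<^sup>2 \<partial>lborel)"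
      by (simp only: integral_mult_right_zero)
    have 2: "(\<Sum>i = 1..n. (c - ?l i) * (cmod (of_real r * f (Inr i)))\<^sup>2)
            = r\<^sup>2 * (\<Sum>i = 1..n. (c - ?l i) * (cmod (f (Inr i)))\<^sup>2)"
      unfolding sum_distrib_left
      by (rule sum.cong) (auto simp: norm_mult power_mult_distrib)
    show ?thesis
      unfolding N[OF that] N[OF H1_scale[OF that]] 1 2 distrib_left
      by simp
  qed
  have bound: "cmod (?F f) \<le> K * N v + K * N f" if f: "f \<in> ?H" for f
  proof -
    let ?Q = "\<lambda>f. \<integral>t. ?W t * (cmod (f (Inl (crit t))))\<^sup>2 \<partial>lborel"
    have Q: "?Q g \<ge> 0" for g :: "point \<Rightarrow> complex"
      using c by (intro integral_nonneg_AE) auto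
    have "cmod (?I f / of_real (4 * pi)) \<le> (?Q v + ?Q f) / (4 * pi)"
      using int(2)[OF f] by (simp add: norm_divide divide_right_mono)
    also have "\<dots> \<le> K * ((?Q v + ?Q f) / (4 * pi))"
      using K1 Q[of v] Q[of f] mult_right_mono[of 1 K "(?Q v + ?Q f) / (4 * pi)"] by simp
    finally have 1: "cmod (?I f / of_real (4 * pi)) \<le> K * ((?Q v + ?Q f) / (4 * pi))" .
    have "cmod (\<Sum>i = 1..n. of_real (?l i) * v (Inr i) * f (Inr i))
            \<le> (\<Sum>i = 1..n. K * ((c - ?l i) * (cmod (v (Inr i)))\<^sup>2 + (c - ?l i) * (cmod (f (Inr i)))\<^sup>2))"
    proof (rule sum_norm_le)
      fix i assume i: "i \<in> {1..n}"
      let ?a = "cmod (v (Inr i))" and ?b = "cmod (f (Inr i))"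
      have p: "?a * ?b \<le> ?a\<^sup>2 + ?b\<^sup>2"
        using zero_le_power2[of "?a - ?b"] zero_le_power2[of ?a] zero_le_power2[of ?b]
        unfolding power2_diff by linarith
      have "cmod (of_real (?l i) * v (Inr i) * f (Inr i)) = \<bar>?l i\<bar> * (?a * ?b)"
        by (simp only: norm_mult norm_of_real mult.assoc)
      also have "\<dots> \<le> (K * (c - ?l i)) * (?a\<^sup>2 + ?b\<^sup>2)"
        using Ki[OF i] p by (intro mult_mono) auto
      finally show "cmod (of_real (?l i) * v (Inr i) * f (Inr i))
          \<le> K * ((c - ?l i) * ?a\<^sup>2 + (c - ?l i) * ?b\<^sup>2)"
        by (simp only: mult.assoc distrib_left)
    qed
    then have 2: "cmod (\<Sum>i = 1..n. of_real (?l i) * v (Inr i) * f (Inr i))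
        \<le> K * ((\<Sum>i = 1..n. (c - ?l i) * (cmod (v (Inr i)))\<^sup>2)
               + (\<Sum>i = 1..n. (c - ?l i) * (cmod (f (Inr i)))\<^sup>2))"
      by (simp only: sum_distrib_left[symmetric] sum.distrib)
    have "cmod (?F f) \<le> cmod (?I f / of_real (4 * pi))
            + cmod (\<Sum>i = 1..n. of_real (?l i) * v (Inr i) * f (Inr i))"
      unfolding F[OF f] by (rule norm_triangle_ineq)
    also have "\<dots> \<le> K * N v + K * N f"
      unfolding N[OF v] N[OF f] using 1 2
      by (simp only: add_divide_distrib distrib_left)
    finally show ?thesis .
  qed
  have "cmod (?F f) \<le> (K * N v + K) * norm_H n \<sigma> c 1 f" if f: "f \<in> ?H" for f
  proof -
    have rb: "\<bar>r\<bar> * cmod (?F f) \<le> K * N v + K * (r\<^sup>2 * N f)" for r :: real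
      using bound[OF H1_scale[OF f, of "of_real r"]]
      by (simp add: scale[OF f] Nscale[OF f] norm_mult)
    show ?thesis
    proof (cases "N f = 0")
      case True
      have "cmod (?F f) = 0"
      proof (rule ccontr)
        assume "cmod (?F f) \<noteq> 0"
        then show False
          using rb[of "(K * N v + 1) / cmod (?F f)"] True K1 N0[OF v]
          by (simp add: abs_of_nonneg)
      qed
      then show ?thesis
        using True by (simp add: norm_H_def flip: N_def)
    next
      case False
      then have s: "sqrt (N f) > 0" using N0[OF f] by simp
      have "cmod (?F f) / sqrt (N f) \<le> K * N v + K"
        using rb[of "1 / sqrt (N f)"] s N0[OF f] False by (simp add: power_divide)
      then show ?thesis
        using s by (simp add: norm_H_def pos_divide_le_eq flip: N_def)
    qed
  qed
  then show ?thesis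
    using add scale unfolding H_dual_def by (auto simp: T_sharp_def)
qed

end

theory Submission
  imports Defs "HOL-Probability.Sinc_Integral"
begin

text \<open>
  Since \<open>h\<close> is real on the real axis, \<open>h (cnj s) = cnj (h s)\<close>, so \<open>c\<^sub>s\<close> is analytic and unimodular
  on the line \<open>Re s = 1/2\<close>, with \<open>c\<^sub>s c\<^bsub>1-s\<^esub> = 1\<close>. The equation says that
  \<open>g = (\<lambda> - \<lambda>\<^sub>w) u - \<theta>\<close> pairs to zero with all of \<open>H\<^sup>1\<close>. Point masses give \<open>g(\<tau>\<^sub>i) = 0\<close>; pairing
  with the symmetrization of an arbitrary \<open>a\<close> on the line gives \<open>\<integral> a g (1 + c\<^sub>s\<^sup>-\<^sup>2) = 0\<close>, and
  \<open>c\<^sub>s\<^sup>2 = -1\<close> only on a discrete set because \<open>c\<^sub>s\<^sup>2 = 1\<close> at \<open>s = 1/2\<close>. Hence \<open>g = 0\<close> almost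
  everywhere, i.e. \<open>u = \<theta> / (\<lambda> - \<lambda>\<^sub>w)\<close>. This function is square-integrable near \<open>w\<close> only if
  \<open>\<theta>(w) = 0\<close>; conversely a zero of \<open>\<theta>\<close> (double if \<open>w = 1/2\<close>) cancels the pole, at \<open>1 - w\<close> too by symmetry, and
  boundedness of \<open>\<theta>\<close> on the line yields the decay at infinity.
\<close>

section \<open>Schwarz reflection for meromorphic functions\<close>

text \<open>Conjugation carries a punctured disc about \<open>cnj z\<close> onto one about
  \<open>z\<close>, so holomorphy off the centre, a finite limit and a pole at the centre each pass
  to the reflected function.\<close>

lemma meromorphic_on_cnj_cnj:
  assumes "f meromorphic_on UNIV"
  shows "(\<lambda>z. cnj (f (cnj z))) meromorphic_on UNIV"
  unfolding meromorphic_on_altdef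
proof (intro ballI conjI)
  fix z :: complex
  have iso: "isolated_singularity_at f (cnj z)" and ness: "not_essential f (cnj z)"
    using assms unfolding meromorphic_on_altdef by auto
  from iso obtain r where r: "r > 0" "f analytic_on ball (cnj z) r - {cnj z}"
    by (auto simp: isolated_singularity_at_def)
  have im: "cnj ` (ball (cnj z) r - {cnj z}) = ball z r - {z}"
  proof (intro equalityI subsetI)
    fix x assume "x \<in> ball z r - {z}"
    then have "cnj x \<in> ball (cnj z) r - {cnj z}"
      by (simp add: dist_norm flip: complex_cnj_diff)
    then show "x \<in> cnj ` (ball (cnj z) r - {cnj z})"
      by (metis complex_cnj_cnj imageI)
  next
    fix x assume "x \<in> cnj ` (ball (cnj z) r - {cnj z})"
    then obtain y where y: "x = cnj y" "y \<in> ball (cnj z) r - {cnj z}" by blast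
    then have "cmod (z - x) = cmod (cnj z - y)"
      by (metis complex_cnj_cnj complex_cnj_diff complex_mod_cnj)
    then show "x \<in> ball z r - {z}" using y by (auto simp: dist_norm)
  qed
  have op: "open (ball z r - {z})" "open (ball (cnj z) r - {cnj z})" by (auto intro: open_delete)
  have "f holomorphic_on cnj ` (ball z r - {z})"
    using r(2) op(2) by (simp add: im[symmetric] image_image analytic_on_open)
  then have "(cnj \<circ> f \<circ> cnj) holomorphic_on (ball z r - {z})"
    using op(1) by (intro holomorphic_on_compose_cnj_cnj)
  then show "isolated_singularity_at (\<lambda>z. cnj (f (cnj z))) z"
    using r(1) op(1) unfolding isolated_singularity_at_def by (auto simp: analytic_on_open o_def)
  have lim: "filterlim cnj (at (cnj z)) (at z)"
    by (auto simp: filterlim_at eventually_at_filter intro!: tendsto_intros)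
  from ness consider l where "(f \<longlongrightarrow> l) (at (cnj z))" | "is_pole f (cnj z)"
    by (auto simp: not_essential_def)
  then show "not_essential (\<lambda>z. cnj (f (cnj z))) z"
  proof cases
    case 1
    then have "((\<lambda>z. cnj (f (cnj z))) \<longlongrightarrow> cnj l) (at z)"
      by (intro tendsto_cnj filterlim_compose[OF _ lim])
    then show ?thesis by (auto simp: not_essential_def)
  next
    case 2
    then have "filterlim (\<lambda>z. f (cnj z)) at_infinity (at z)"
      unfolding is_pole_def by (rule filterlim_compose[OF _ lim])
    then have "is_pole (\<lambda>z. cnj (f (cnj z))) z"
      by (simp add: is_pole_def filterlim_at_infinity_conv_norm_at_top)
    then show ?thesis by (auto simp: not_essential_def)
  qed
qed

text \<open>The difference of the two sides is meromorphic and vanishes on the real axis, which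
  accumulates at 0, so it cannot be nonzero off a sparse set. Being meromorphic leaves the values on
  a sparse set free, hence the cosparse quantifier.\<close>

lemma meromorphic_reflection_cosparse:
  assumes mero: "f meromorphic_on UNIV" and real: "\<forall>x::real. f (of_real x) \<in> \<real>"
  shows "\<forall>\<^sub>\<approx>z\<in>UNIV. f (cnj z) = cnj (f z)"
proof -
  let ?d = "\<lambda>z. f z - cnj (f (cnj z))"
  have "?d meromorphic_on UNIV"
    by (intro meromorphic_intros meromorphic_on_cnj_cnj mero)
  then have "(\<forall>\<^sub>\<approx>z\<in>UNIV. ?d z = 0) \<or> (\<forall>\<^sub>\<approx>z\<in>UNIV. ?d z \<noteq> 0)"
    by (intro meromorphic_imp_constant_or_avoid) auto
  moreover have False if "\<forall>\<^sub>\<approx>z\<in>UNIV. ?d z \<noteq> 0"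
  proof -
    have "eventually (\<lambda>z. ?d z \<noteq> 0) (at 0)"
      using that by (rule eventually_cosparse_imp_eventually_at) auto
    moreover have "filterlim complex_of_real (at 0) (at 0)"
      by (auto simp: filterlim_at eventually_at_filter intro!: tendsto_eq_intros)
    ultimately have "eventually (\<lambda>x::real. ?d (of_real x) \<noteq> 0) (at 0)"
      by (rule eventually_compose_filterlim)
    moreover have "?d (of_real x) = 0" for x :: real
      using real by (auto simp: complex_cnj_complex_of_real Reals_cnj_iff)
    ultimately show False by simp
  qed
  ultimately have "\<forall>\<^sub>\<approx>z\<in>UNIV. ?d z = 0" by blast
  then show ?thesis
    by eventually_elim (metis complex_cnj_cnj right_minus_eq)
qed

section \<open>The parametrized line \<open>Re s = 1/2\<close>\<close>

lemma crit_conv: "crit t = of_real (1/2) + \<i> * of_real t"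
  by (simp add: crit_def complex_eq_iff)

lemma one_minus_crit: "1 - crit t = crit (- t)"
  by (simp add: crit_def complex_eq_iff)

lemma cnj_crit: "cnj (crit t) = crit (- t)"
  by (simp add: crit_def complex_eq_iff)

lemma inj_crit: "inj crit"
  by (auto simp: inj_on_def crit_def)

lemma filterlim_crit: "filterlim crit (at (crit t)) (at t)"
proof -
  have "(crit \<longlongrightarrow> crit t) (at t)"
    unfolding crit_conv by (intro tendsto_intros)
  then show ?thesis
    by (auto simp: filterlim_at eventually_at_filter crit_def)
qed

text \<open>A sparse set is countable, and \<open>crit\<close> is injective, so the exceptional
  parameters are countable and hence null.\<close>

lemma AE_crit_cosparse:
  assumes "\<forall>\<^sub>\<approx>z\<in>UNIV. P z"
  shows "AE t in lborel. P (crit t)"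
proof -
  have "countable {z. \<not> P z}"
    using sparse_imp_countable[of UNIV "{z. \<not> P z}"] assms by (auto simp: eventually_cosparse)
  then have "countable (crit -` {z. \<not> P z})"
    using countable_image_inj_on[of crit "crit -` {z. \<not> P z}"] inj_crit
    by (metis countable_subset image_vimage_subset inj_on_subset subset_UNIV)
  then have "crit -` {z. \<not> P z} \<in> null_sets lborel"
    by (rule countable_imp_null_set_lborel)
  then show ?thesis
    by (rule AE_I') auto
qed

section \<open>Unimodularity and reflection of \<open>c_fun h\<close> on the line\<close>

text \<open>On the line \<open>1 - s\<close> equals \<open>cnj s\<close>, so by reflection the
  quotient is \<open>cnj (h s) / h s\<close> off a sparse set. Its bounded modulus excludes poles
  there, and continuity then carries the identities to every point of the line.\<close>

lemma
  assumes nice: "h nicely_meromorphic_on UNIV" and nz: "h s0 \<noteq> 0"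
    and real: "\<forall>x::real. h (of_real x) \<in> \<real>"
  shows c_fun_analytic_crit: "c_fun h analytic_on {crit t}"
    and norm_c_fun_crit: "cmod (c_fun h (crit t)) = 1"
    and c_fun_reflect: "c_fun h (crit (- t)) * c_fun h (crit t) = 1"
    and c_fun_sq_ne: "AE t in lborel. (c_fun h (crit t))\<^sup>2 + 1 \<noteq> 0"
proof -
  define q where "q s = h (1 - s) / h s" for s
  have c: "c_fun h = remove_sings q"
    by (simp add: c_fun_def q_def [abs_def])
  have hm: "h meromorphic_on UNIV" using nice by (simp add: nicely_meromorphic_on_def)
  have hm1: "(\<lambda>s. h (1 - s)) meromorphic_on UNIV"
    by (rule meromorphic_on_compose[OF hm]) (auto intro!: analytic_intros)
  have qm: "q meromorphic_on UNIV"
    unfolding q_def by (intro meromorphic_intros hm hm1)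
  have cn: "c_fun h nicely_meromorphic_on UNIV"
    unfolding c by (rule remove_sings_nicely_meromorphic[OF qm])
  have nz: "\<forall>\<^sub>\<approx>z\<in>UNIV. h z \<noteq> 0"
    using nicely_meromorphic_imp_constant_or_avoid[OF nice, of 0] nz by auto
  have ceq: "\<forall>\<^sub>\<approx>z\<in>UNIV. c_fun h z = q z"
    unfolding c by (rule eventually_remove_sings_eq[OF qm])
  have refl: "\<forall>\<^sub>\<approx>z\<in>UNIV. h (cnj z) = cnj (h z)"
    by (rule meromorphic_reflection_cosparse[OF hm real])
  \<comment> \<open>A cosparse property holds along the line in a punctured neighbourhood of each
    parameter. This is enough for limits, which recover the values at the exceptional
    points.\<close>
  have lim_at: "eventually (\<lambda>u. P (crit u)) (at t)" if "\<forall>\<^sub>\<approx>z\<in>UNIV. P z" for P t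
    by (rule eventually_compose_filterlim[OF eventually_cosparse_imp_eventually_at[OF that] filterlim_crit]) auto
  have ev1: "eventually (\<lambda>u. cmod (c_fun h (crit u)) = 1) (at t)" for t
    using lim_at[OF nz, of t] lim_at[OF ceq, of t] lim_at[OF refl, of t]
    by eventually_elim (simp add: q_def one_minus_crit cnj_crit norm_divide)
  show an: "c_fun h analytic_on {crit t}" for t
  proof (rule nicely_meromorphic_on_imp_analytic_at[OF cn])
    show "\<not> is_pole (c_fun h) (crit t)"
    proof
      assume "is_pole (c_fun h) (crit t)"
      then have "filterlim (\<lambda>u. c_fun h (crit u)) at_infinity (at t)"
        unfolding is_pole_def by (rule filterlim_compose[OF _ filterlim_crit])
      then have "filterlim (\<lambda>u. cmod (c_fun h (crit u))) at_top (at t)"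
        by (simp add: filterlim_at_infinity_conv_norm_at_top)
      then have "eventually (\<lambda>u. cmod (c_fun h (crit u)) \<ge> 2) (at t)"
        by (simp add: filterlim_at_top)
      with ev1[of t] have "eventually (\<lambda>u::real. False) (at t)"
        by eventually_elim simp
      then show False by simp
    qed
  qed auto
  have lim: "((\<lambda>u. c_fun h (crit u)) \<longlongrightarrow> c_fun h (crit t)) (at t)" for t
  proof -
    have "(c_fun h \<longlongrightarrow> c_fun h (crit t)) (at (crit t))"
      using an[of t] by (simp add: analytic_at_imp_isCont isContD)
    then show ?thesis by (rule filterlim_compose[OF _ filterlim_crit])
  qed
  show nm: "cmod (c_fun h (crit t)) = 1" for t
  proof (rule tendsto_unique[OF _ tendsto_norm[OF lim]])
    show "((\<lambda>u. cmod (c_fun h (crit u))) \<longlongrightarrow> 1) (at t)"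
      using ev1[of t] by (rule tendsto_eventually)
  qed simp
  show cc: "c_fun h (crit (- t)) * c_fun h (crit t) = 1" for t
  proof -
    have m: "filterlim uminus (at (- t)) (at t)"
      by (auto simp: filterlim_at eventually_at_filter intro!: tendsto_intros)
    have flip: "eventually (\<lambda>u. P (crit (- u))) (at t)" if "\<forall>\<^sub>\<approx>z\<in>UNIV. P z" for P
      by (rule eventually_compose_filterlim[OF lim_at[OF that] m])
    have "eventually (\<lambda>u. c_fun h (crit (- u)) * c_fun h (crit u) = 1) (at t)"
      using lim_at[OF nz, of t] lim_at[OF ceq, of t] flip[OF nz] flip[OF ceq]
      by eventually_elim (simp add: q_def one_minus_crit)
    then have "((\<lambda>u. c_fun h (crit (- u)) * c_fun h (crit u)) \<longlongrightarrow> 1) (at t)"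
      by (rule tendsto_eventually)
    moreover have "((\<lambda>u. c_fun h (crit (- u)) * c_fun h (crit u)) \<longlongrightarrow>
        c_fun h (crit (- t)) * c_fun h (crit t)) (at t)"
      by (intro tendsto_mult lim filterlim_compose[OF lim m])
    ultimately show ?thesis by (intro tendsto_unique[of "at t"]) auto
  qed
  let ?F = "\<lambda>s. (c_fun h s)\<^sup>2 + 1"
  have "?F meromorphic_on UNIV"
    using cn by (intro meromorphic_intros) (auto simp: nicely_meromorphic_on_def)
  then have "(\<forall>\<^sub>\<approx>z\<in>UNIV. ?F z = 0) \<or> (\<forall>\<^sub>\<approx>z\<in>UNIV. ?F z \<noteq> 0)"
    by (intro meromorphic_imp_constant_or_avoid) auto
  moreover have False if "\<forall>\<^sub>\<approx>z\<in>UNIV. ?F z = 0"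
  proof -
    have "((\<lambda>u. ?F (crit u)) \<longlongrightarrow> 0) (at 0)"
      using lim_at[OF that] by (rule tendsto_eventually)
    moreover have "((\<lambda>u. ?F (crit u)) \<longlongrightarrow> ?F (crit 0)) (at 0)"
      by (intro tendsto_intros lim)
    ultimately have "?F (crit 0) = 0" by (intro tendsto_unique[of "at 0"]) auto
    then show False using cc[of 0] by (simp add: power2_eq_square)
  qed
  ultimately show "AE t in lborel. ?F (crit t) \<noteq> 0"
    using AE_crit_cosparse by blast
qed

section \<open>Local and global estimates; membership in and pairing with the space of order
  one\<close>

lemma integrable_inverse_1_plus_sq: "integrable lborel (\<lambda>t::real. inverse (1 + t\<^sup>2))"
  using integrable_inverse_1_plus_square by (simp add: set_integrable_def)

lemma H_space_crit_minus:
  "f \<in> H_space h \<sigma> \<eta> c k \<Longrightarrow> 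
   AE t in lborel. f (Inl (crit (- t))) = of_real \<eta> * f (Inl (crit t)) / c_fun h (crit t)"
  by (simp add: H_space_def one_minus_crit)

lemma Im_crit [simp]: "Im (crit t) = t"
  by (simp add: crit_def)

lemma divide_one_plus_square_le:
  assumes "x \<ge> (0::real)"
  shows "x / (1 + x\<^sup>2) \<le> 1/2" "x\<^sup>2 / (1 + x\<^sup>2) \<le> 1"
proof -
  have p: "1 + x\<^sup>2 > 0" by (simp add: add_pos_nonneg)
  have "2 * x \<le> 1 + x\<^sup>2" using zero_le_power2[of "x - 1"] unfolding power2_diff by simp
  then show "x / (1 + x\<^sup>2) \<le> 1/2" using p by (simp add: divide_le_eq)
  show "x\<^sup>2 / (1 + x\<^sup>2) \<le> 1" using p by (simp add: divide_le_eq)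
qed

text \<open>Dividing out a zero, with the derivative as value of the quotient at \<open>z\<close>,
  leaves an analytic and hence locally bounded factor. If the derivative vanishes too, this factor
  has a zero at \<open>z\<close> and can be divided once more.\<close>

lemma analytic_zero_bound:
  assumes f: "f analytic_on {z}" and "f z = 0"
  shows "\<exists>r>0. \<exists>L\<ge>0. \<forall>s. dist z s < r \<longrightarrow> cmod (f s) \<le> L * cmod (s - z)"
    and "deriv f z = 0 \<Longrightarrow> \<exists>r>0. \<exists>L\<ge>0. \<forall>s. dist z s < r \<longrightarrow> cmod (f s) \<le> L * (cmod (s - z))\<^sup>2"
proof -
  have quot: "\<exists>g. g analytic_on {z} \<and> g z = deriv f z \<and> (\<forall>s. f s = (s - z) * g s)"
    if f: "f analytic_on {z}" "f z = 0" for f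
  proof -
    obtain S where S: "open S" "z \<in> S" "f holomorphic_on S"
      using f(1) by (auto simp: analytic_at)
    let ?g = "\<lambda>s. if s = z then deriv f z else (f s - f z) / (s - z)"
    have "?g holomorphic_on S" by (rule pole_lemma_open[OF S(3,1)])
    then have "?g analytic_on {z}" using S by (auto simp: analytic_at)
    then show ?thesis using f(2) by (intro exI[of _ ?g]) auto
  qed
  have bdd: "\<exists>r>0. \<exists>L\<ge>0. \<forall>s. dist z s < r \<longrightarrow> cmod (g s) \<le> L" if "g analytic_on {z}" for g
  proof -
    have "isCont g z" using that by (rule analytic_at_imp_isCont)
    then obtain r where r: "r > 0" "\<And>s. dist s z < r \<Longrightarrow> cmod (g s - g z) < 1"
      unfolding continuous_at_eps_delta by (auto simp: dist_norm dest: spec[of _ 1])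
    have "cmod (g s) \<le> cmod (g z) + 1" if "dist z s < r" for s
      using r(2)[of s] that norm_triangle_ineq2[of "g s" "g z"] by (simp add: dist_commute)
    then show ?thesis using r(1) by (intro exI[of _ r] conjI exI[of _ "cmod (g z) + 1"]) auto
  qed
  obtain g where g: "g analytic_on {z}" "g z = deriv f z" "\<And>s. f s = (s - z) * g s"
    using quot[OF assms] by blast
  obtain r L where "r > 0" "L \<ge> 0" "\<And>s. dist z s < r \<Longrightarrow> cmod (g s) \<le> L"
    using bdd[OF g(1)] by blast
  moreover from this have "cmod (f s) \<le> L * cmod (s - z)" if "dist z s < r" for s
    using mult_right_mono[of "cmod (g s)" L "cmod (s - z)"] that
    by (simp add: g(3) norm_mult mult.commute)
  ultimately show "\<exists>r>0. \<exists>L\<ge>0. \<forall>s. dist z s < r \<longrightarrow> cmod (f s) \<le> L * cmod (s - z)"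
    by blast
  assume "deriv f z = 0"
  then obtain k where k: "k analytic_on {z}" "\<And>s. g s = (s - z) * k s"
    using quot[OF g(1)] g(2) by auto
  obtain r L where "r > 0" "L \<ge> 0" "\<And>s. dist z s < r \<Longrightarrow> cmod (k s) \<le> L"
    using bdd[OF k(1)] by blast
  moreover from this have "cmod (f s) \<le> L * (cmod (s - z))\<^sup>2" if "dist z s < r" for s
    using mult_right_mono[of "cmod (k s)" L "(cmod (s - z))\<^sup>2"] that
    by (simp add: g(3) k(2) norm_mult power2_eq_square mult_ac)
  ultimately show "\<exists>r>0. \<exists>L\<ge>0. \<forall>s. dist z s < r \<longrightarrow> cmod (f s) \<le> L * (cmod (s - z))\<^sup>2"
    by blast
qed

lemma crit_diff: "cmod (crit t - crit b) = \<bar>t - b\<bar>"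
  by (simp add: crit_def norm_complex_def)

lemma lam_crit: "lam (crit t) = of_real (- 1/4 - t\<^sup>2)"
  by (simp add: lam_def crit_def complex_eq_iff power2_eq_square)

lemma H1_I:
  assumes [measurable]: "(\<lambda>t. f (Inl (crit t))) \<in> borel_measurable borel"
    and int: "integrable lborel (\<lambda>t. (c + 1/4 + t\<^sup>2) * (cmod (f (Inl (crit t))))\<^sup>2)"
    and sym: "AE t in lborel. f (Inl (crit (- t))) = of_real \<eta> * f (Inl (crit t)) / c_fun h (crit t)"
    and c: "c > 0"
  shows "f \<in> H_space h \<sigma> \<eta> c 1"
proof -
  have p: "c + 1/4 + t\<^sup>2 \<ge> 0" for t
    using c zero_le_power2[of t] by linarith
  have w: "weight \<sigma> c (1/2) f (Inl (crit t)) = of_real (sqrt (c + 1/4 + t\<^sup>2)) * f (Inl (crit t))" for t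
  proof -
    have "complex_of_real (c + 1/4 + t\<^sup>2) powr of_real (1/2) = of_real ((c + 1/4 + t\<^sup>2) powr (1/2))"
      using p by (rule powr_of_real)
    then show ?thesis
      using p by (simp add: weight_def lam_at_def c_minus_lam_crit powr_half_sqrt
          del: of_real_add of_real_power of_real_divide)
  qed
  have "integrable lborel (\<lambda>t. (cmod (weight \<sigma> c (1/2) f (Inl (crit t))))\<^sup>2)"
    using int p by (simp add: w norm_mult power_mult_distrib)
  moreover have "(\<lambda>t. weight \<sigma> c (1/2) f (Inl (crit t))) \<in> borel_measurable lborel"
    unfolding w by measurable
  ultimately show ?thesis
    using assms by (simp add: H_space_def L2_crit_def one_minus_crit)
qed

text \<open>This is what lets a function that is merely bounded on the line, such as
  \<open>theta\<close>, act on the space: the weight \<open>c + 1/4 + t\<^sup>2\<close> leaves room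
  for the integrable function \<open>inverse (1 + t\<^sup>2)\<close>.\<close>

lemma H1_bounded_mult_integrable:
  assumes f: "f \<in> H_space h \<sigma> \<eta> c 1" and c: "c > 0"
    and [measurable]: "\<phi> \<in> borel_measurable borel" and le: "\<And>t. cmod (\<phi> t) \<le> 2"
  shows "integrable lborel (\<lambda>t. \<phi> t * f (Inl (crit t)))"
proof -
  let ?f = "\<lambda>t. f (Inl (crit t))"
  have [measurable]: "?f \<in> borel_measurable borel" using H1_line(1)[OF f c] by simp
  have "integrable lborel (\<lambda>t. 4 * inverse (1 + t\<^sup>2) + (c + 1/4 + t\<^sup>2) * (cmod (?f t))\<^sup>2)"
    by (intro Bochner_Integration.integrable_add integrable_mult_right
        integrable_inverse_1_plus_sq H1_line(2)[OF f c])
  then show ?thesis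
  proof (rule Bochner_Integration.integrable_bound)
    show "AE t in lborel. cmod (\<phi> t * ?f t)
        \<le> norm (4 * inverse (1 + t\<^sup>2) + (c + 1/4 + t\<^sup>2) * (cmod (?f t))\<^sup>2)"
    proof (rule AE_I2)
      fix t
      let ?x = "cmod (?f t)"
      have W: "1/4 * (1 + t\<^sup>2) \<le> c + 1/4 + t\<^sup>2" using c zero_le_power2[of t] by argo
      have p: "1 + t\<^sup>2 > 0" by (simp add: add_pos_nonneg)
      \<comment> \<open>The inequality of arithmetic and geometric means, split so that the
        coefficient \<open>1/4\<close> of \<open>1 + t\<^sup>2\<close> stays below the weight for
        every positive \<open>c\<close>.\<close>
      have "0 \<le> (2 * inverse (sqrt (1 + t\<^sup>2)) - 1/2 * (sqrt (1 + t\<^sup>2) * ?x))\<^sup>2" by simp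
      also have "\<dots> = 4 * inverse (1 + t\<^sup>2) + 1/4 * (1 + t\<^sup>2) * ?x\<^sup>2 - 2 * ?x"
        using p by (simp add: power2_diff power_mult_distrib power_divide power_inverse)
      finally have "2 * ?x \<le> 4 * inverse (1 + t\<^sup>2) + 1/4 * (1 + t\<^sup>2) * ?x\<^sup>2" by simp
      also have "\<dots> \<le> 4 * inverse (1 + t\<^sup>2) + (c + 1/4 + t\<^sup>2) * ?x\<^sup>2"
        using W by (intro add_mono mult_right_mono) auto
      finally have "2 * ?x \<le> norm (4 * inverse (1 + t\<^sup>2) + (c + 1/4 + t\<^sup>2) * ?x\<^sup>2)" by simp
      moreover have "cmod (\<phi> t * ?f t) \<le> 2 * ?x"
        using le[of t] by (simp add: norm_mult mult_right_mono)
      ultimately show "cmod (\<phi> t * ?f t)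
          \<le> norm (4 * inverse (1 + t\<^sup>2) + (c + 1/4 + t\<^sup>2) * ?x\<^sup>2)" by linarith
    qed
  qed measurable
qed

section \<open>Functions of the real parameter \<open>t\<close>\<close>

text \<open>The assumption \<open>nonzero\<close> excludes the zero function, whose quotient would
  vanish identically instead of being unimodular. In the theorem it comes from the finiteness of the
  zeros to the right of the line.\<close>

locale critical_line =
  fixes h :: "complex \<Rightarrow> complex" and \<sigma> :: "nat \<Rightarrow> real" and \<eta> c :: real
  assumes nice: "h nicely_meromorphic_on UNIV"
    and nonzero: "\<exists>s. h s \<noteq> 0"
    and real_on_real: "\<forall>x::real. h (of_real x) \<in> \<real>"
    and \<eta>: "\<eta> \<in> {1, -1}"
    and c_pos: "c > 0"
begin

definition \<kappa> :: "real \<Rightarrow> complex" where "\<kappa> t = c_fun h (crit t)"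

definition \<Theta> :: "real \<Rightarrow> complex" where "\<Theta> t = 1 + of_real \<eta> * \<kappa> t"

lemma analytic_crit: "c_fun h analytic_on {crit t}"
  using c_fun_analytic_crit nice nonzero real_on_real by blast

lemma norm_\<kappa> [simp]: "cmod (\<kappa> t) = 1"
  unfolding \<kappa>_def using norm_c_fun_crit nice nonzero real_on_real by blast

lemma \<kappa>_nonzero [simp]: "\<kappa> t \<noteq> 0"
  using norm_\<kappa>[of t] by (metis norm_zero zero_neq_one)

lemma \<kappa>_minus: "\<kappa> (- t) = 1 / \<kappa> t"
proof -
  have "\<kappa> (- t) * \<kappa> t = 1"
    unfolding \<kappa>_def using c_fun_reflect nice nonzero real_on_real by blast
  then show ?thesis by (simp add: eq_divide_eq)
qed

lemma \<kappa>_sq_ne: "AE t in lborel. (\<kappa> t)\<^sup>2 + 1 \<noteq> 0"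
  unfolding \<kappa>_def using c_fun_sq_ne nice nonzero real_on_real by blast

lemma \<eta>_sq [simp]: "complex_of_real \<eta> * of_real \<eta> = 1"
  using \<eta> by auto

lemma norm_\<eta> [simp]: "\<bar>\<eta>\<bar> = 1"
  using \<eta> by auto

lemma isCont_crit: "isCont crit t"
  unfolding crit_conv[abs_def] by (intro continuous_intros)

lemma isCont_\<kappa>: "isCont \<kappa> t"
proof -
  have "isCont (\<lambda>t. c_fun h (crit t)) t"
    using isCont_crit analytic_at_imp_isCont[OF analytic_crit[of t]]
    by (rule isCont_o2)
  then show ?thesis by (simp add: \<kappa>_def[abs_def])
qed

lemma isCont_\<Theta>: "isCont \<Theta> t"
  unfolding \<Theta>_def[abs_def] by (intro continuous_intros isCont_\<kappa>)

lemma \<kappa>_measurable [measurable]: "\<kappa> \<in> borel_measurable borel"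
  by (intro borel_measurable_continuous_onI continuous_at_imp_continuous_on ballI isCont_\<kappa>)

lemma \<Theta>_measurable [measurable]: "\<Theta> \<in> borel_measurable borel"
  unfolding \<Theta>_def[abs_def] by measurable

lemma norm_\<Theta>_le: "cmod (\<Theta> t) \<le> 2"
  unfolding \<Theta>_def using norm_triangle_ineq[of 1 "of_real \<eta> * \<kappa> t"] by (simp add: norm_mult)

lemma \<Theta>_minus: "\<Theta> (- t) = of_real \<eta> * \<Theta> t / \<kappa> t"
  by (simp add: \<Theta>_def \<kappa>_minus field_simps)

lemma norm_\<Theta>_minus: "cmod (\<Theta> (- t)) = cmod (\<Theta> t)"
  by (simp add: \<Theta>_minus norm_mult norm_divide)

lemma theta_crit: "theta h \<sigma> \<eta> (Inl (crit t)) = \<Theta> t"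
  by (simp add: theta_def \<Theta>_def \<kappa>_def)

section \<open>The equation as orthogonality of a residual to all test functions\<close>

abbreviation H1 :: "(point \<Rightarrow> complex) set" where "H1 \<equiv> H_space h \<sigma> \<eta> c 1"

text \<open>This is \<open>g\<close> of the opening outline for \<open>w = crit a\<close>, kept as a
  function rather than a functional so that its vanishing can be tested pointwise.\<close>

definition residual :: "real \<Rightarrow> (point \<Rightarrow> complex) \<Rightarrow> point \<Rightarrow> complex" where
  "residual a u x = (lam_at \<sigma> x - lam (crit a)) * u x - theta h \<sigma> \<eta> x"

lemma residual_crit:
  "residual a u (Inl (crit t)) = of_real (a\<^sup>2 - t\<^sup>2) * u (Inl (crit t)) - \<Theta> t"
  by (simp add: residual_def lam_at_def lam_crit theta_crit)

lemma residual_measurable: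
  assumes "u \<in> H1"
  shows "(\<lambda>t. residual a u (Inl (crit t))) \<in> borel_measurable borel"
proof -
  have [measurable]: "(\<lambda>t. u (Inl (crit t))) \<in> borel_measurable borel"
    using H1_line(1)[OF assms c_pos] by simp
  show ?thesis unfolding residual_crit by measurable
qed

text \<open>The operator acts as multiplication by \<open>lam_at \<sigma>\<close>, so the three
  pairings merge into one as soon as each integral converges separately: the multipliers are
  dominated by multiples of the weight, and \<open>\<Theta>\<close> is bounded.\<close>

lemma
  assumes u: "u \<in> H1" and f: "f \<in> H1"
  shows residual_integrable: "integrable lborel (\<lambda>t. residual a u (Inl (crit t)) * f (Inl (crit t)))"
    and residual_pairing:
      "T_sharp h n \<sigma> \<eta> c u f - lam (crit a) * to_dual h n \<sigma> \<eta> c u f - to_dual h n \<sigma> \<eta> c (theta h \<sigma> \<eta>) f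
       = (\<integral>t. residual a u (Inl (crit t)) * f (Inl (crit t)) \<partial>lborel) / of_real (4 * pi)
         + (\<Sum>i = 1..n. residual a u (Inr i) * f (Inr i))"
proof -
  let ?P = "\<lambda>m t. of_real (m t) * u (Inl (crit t)) * f (Inl (crit t))"
  let ?l = "\<lambda>t::real. - 1/4 - t\<^sup>2"
  have l_le: "\<bar>?l t\<bar> \<le> c + 1/4 + t\<^sup>2" for t
    using c_pos zero_le_power2[of t] by linarith
  have I1: "integrable lborel (?P ?l)"
    by (rule H1_integrable(1)[OF u f c_pos _ l_le]) (intro continuous_intros)
  \<comment> \<open>The constant \<open>lam (crit a)\<close> may exceed the weight in modulus, so
    the bound is applied to the constant \<open>c\<close> and the result rescaled.\<close>
  have "integrable lborel (?P (\<lambda>t. c))"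
    by (rule H1_integrable(1)[OF u f c_pos]) (use c_pos in auto)
  then have "integrable lborel (\<lambda>t. of_real (?l a / c) * ?P (\<lambda>t. c) t)"
    by (rule integrable_mult_right)
  then have I2: "integrable lborel (?P (\<lambda>t. ?l a))"
    using c_pos by (simp add: mult.assoc[symmetric] flip: of_real_mult)
  have I3: "integrable lborel (\<lambda>t. \<Theta> t * f (Inl (crit t)))"
    by (rule H1_bounded_mult_integrable[OF f c_pos \<Theta>_measurable norm_\<Theta>_le])
  have R: "residual a u (Inl (crit t)) * f (Inl (crit t))
      = ?P ?l t - ?P (\<lambda>t. ?l a) t - \<Theta> t * f (Inl (crit t))" for t
    by (simp add: residual_crit algebra_simps)
  show "integrable lborel (\<lambda>t. residual a u (Inl (crit t)) * f (Inl (crit t)))"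
    unfolding R by (intro Bochner_Integration.integrable_diff I1 I2 I3)
  have J: "(\<integral>t. residual a u (Inl (crit t)) * f (Inl (crit t)) \<partial>lborel)
      = (\<integral>t. ?P ?l t \<partial>lborel) - (\<integral>t. ?P (\<lambda>t. ?l a) t \<partial>lborel) - (\<integral>t. \<Theta> t * f (Inl (crit t)) \<partial>lborel)"
    unfolding R by (simp only: Bochner_Integration.integral_diff[OF I1 I2]
      Bochner_Integration.integral_diff[OF Bochner_Integration.integrable_diff[OF I1 I2] I3])
  have T: "T_sharp h n \<sigma> \<eta> c u f = (\<integral>t. ?P ?l t \<partial>lborel) / of_real (4 * pi)
      + (\<Sum>i = 1..n. lam_at \<sigma> (Inr i) * u (Inr i) * f (Inr i))"
    unfolding T_sharp_mult[OF u f c_pos] by (rule inner_L2_mult) (simp add: lam_at_def lam_crit)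
  have L: "lam (crit a) * to_dual h n \<sigma> \<eta> c u f = (\<integral>t. ?P (\<lambda>t. ?l a) t \<partial>lborel) / of_real (4 * pi)
      + (\<Sum>i = 1..n. lam (crit a) * u (Inr i) * f (Inr i))"
    using f inner_L2_mult[of "\<lambda>x. 1" "\<lambda>t. 1" n u f]
    by (simp add: to_dual_def lam_crit distrib_left sum_distrib_left mult.assoc)
  have Th: "to_dual h n \<sigma> \<eta> c (theta h \<sigma> \<eta>) f = (\<integral>t. \<Theta> t * f (Inl (crit t)) \<partial>lborel) / of_real (4 * pi)
      + (\<Sum>i = 1..n. theta h \<sigma> \<eta> (Inr i) * f (Inr i))"
    using f inner_L2_mult[of "\<lambda>x. 1" "\<lambda>t. 1" n "theta h \<sigma> \<eta>" f]
    by (simp add: to_dual_def theta_crit)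
  have S: "(\<Sum>i = 1..n. residual a u (Inr i) * f (Inr i))
      = (\<Sum>i = 1..n. lam_at \<sigma> (Inr i) * u (Inr i) * f (Inr i))
        - (\<Sum>i = 1..n. lam (crit a) * u (Inr i) * f (Inr i))
        - (\<Sum>i = 1..n. theta h \<sigma> \<eta> (Inr i) * f (Inr i))"
    unfolding sum_subtractf[symmetric] by (rule sum.cong) (auto simp: residual_def algebra_simps)
  show "T_sharp h n \<sigma> \<eta> c u f - lam (crit a) * to_dual h n \<sigma> \<eta> c u f - to_dual h n \<sigma> \<eta> c (theta h \<sigma> \<eta>) f
       = (\<integral>t. residual a u (Inl (crit t)) * f (Inl (crit t)) \<partial>lborel) / of_real (4 * pi)
         + (\<Sum>i = 1..n. residual a u (Inr i) * f (Inr i))"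
    unfolding T L Th J S by (simp add: diff_divide_distrib)
qed

lemma solves_iff:
  assumes u: "u \<in> H1"
  shows "solves h n \<sigma> \<eta> c (crit a) u \<longleftrightarrow>
    (\<forall>f\<in>H1. (\<integral>t. residual a u (Inl (crit t)) * f (Inl (crit t)) \<partial>lborel) / of_real (4 * pi)
         + (\<Sum>i = 1..n. residual a u (Inr i) * f (Inr i)) = 0)"
proof -
  have "solves h n \<sigma> \<eta> c (crit a) u \<longleftrightarrow>
     (\<forall>f\<in>H1. T_sharp h n \<sigma> \<eta> c u f - lam (crit a) * to_dual h n \<sigma> \<eta> c u f
        = to_dual h n \<sigma> \<eta> c (theta h \<sigma> \<eta>) f)"
    unfolding solves_def fun_eq_iff by (auto simp: to_dual_def restrict_def)
  then show ?thesis
    by (simp only: residual_pairing[OF u, symmetric] right_minus_eq cong: ball_cong)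
qed

text \<open>The factor \<open>a\<^sup>2 - t\<^sup>2\<close> is even, so the residual inherits the
  common symmetry of \<open>u\<close> and \<open>\<Theta>\<close>.\<close>

lemma residual_symmetric:
  assumes u: "u \<in> H1"
  shows "AE t in lborel. residual a u (Inl (crit (- t))) = of_real \<eta> * residual a u (Inl (crit t)) / \<kappa> t"
  using H_space_crit_minus[OF u]
  by eventually_elim (simp add: residual_crit \<Theta>_minus \<kappa>_def[symmetric] algebra_simps diff_divide_distrib add_divide_distrib)

section \<open>Test functions and the vanishing of the residual\<close>

text \<open>The weight is at most \<open>(c + 1) * (1 + t\<^sup>2)\<close>, which cancels one of the
  two factors \<open>inverse (1 + t\<^sup>2)\<close> in the square and leaves an integrable
  one.\<close>

lemma integrable_weight_decay:
  assumes [measurable]: "f \<in> borel_measurable borel"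
    and le: "\<And>t. cmod (f t) \<le> K * inverse (1 + t\<^sup>2)"
  shows "integrable lborel (\<lambda>t. (c + 1/4 + t\<^sup>2) * (cmod (f t))\<^sup>2)"
proof -
  have "integrable lborel (\<lambda>t. ((c + 1) * K\<^sup>2) * inverse (1 + t\<^sup>2))"
    by (intro integrable_mult_right integrable_inverse_1_plus_sq)
  then show ?thesis
  proof (rule Bochner_Integration.integrable_bound)
    show "AE t in lborel. norm ((c + 1/4 + t\<^sup>2) * (cmod (f t))\<^sup>2)
        \<le> norm ((c + 1) * K\<^sup>2 * inverse (1 + t\<^sup>2))"
    proof (rule AE_I2)
      fix t :: real
      have p: "1 + t\<^sup>2 > 0" by (simp add: add_pos_nonneg)
      have "0 \<le> c * t\<^sup>2" using c_pos by simp
      then have W: "c + 1/4 + t\<^sup>2 \<le> (c + 1) * (1 + t\<^sup>2)" using c_pos by (simp add: algebra_simps)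
      have "(cmod (f t))\<^sup>2 \<le> (K * inverse (1 + t\<^sup>2))\<^sup>2"
        using le[of t] by (intro power_mono) auto
      then have "(c + 1/4 + t\<^sup>2) * (cmod (f t))\<^sup>2 \<le> ((c + 1) * (1 + t\<^sup>2)) * (K * inverse (1 + t\<^sup>2))\<^sup>2"
        using W c_pos by (intro mult_mono) auto
      also have "\<dots> = (c + 1) * K\<^sup>2 * inverse (1 + t\<^sup>2)"
        using p by (simp only: power_mult_distrib power2_eq_square) simp
      finally have "(c + 1/4 + t\<^sup>2) * (cmod (f t))\<^sup>2 \<le> (c + 1) * K\<^sup>2 * inverse (1 + t\<^sup>2)" .
      moreover have "0 \<le> (c + 1/4 + t\<^sup>2) * (cmod (f t))\<^sup>2" using c_pos by auto
      ultimately show "norm ((c + 1/4 + t\<^sup>2) * (cmod (f t))\<^sup>2) \<le> norm ((c + 1) * K\<^sup>2 * inverse (1 + t\<^sup>2))"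
        by simp
    qed
  qed measurable
qed

text \<open>Integrability and symmetry concern the line only, so point masses at the
  \<open>\<tau>\<^sub>i\<close> are admissible tests.\<close>

lemma delta_in_H1: "case_sum (\<lambda>s. 0) (\<lambda>j. if j = i then 1 else 0) \<in> H1"
  by (rule H1_I) (use c_pos in auto)

text \<open>Adding the reflected copy enforces the symmetry, because
  \<open>\<kappa> (- t) = 1 / \<kappa> t\<close> and \<open>\<eta>\<close> squares to 1.\<close>

lemma symmetrized_in_H1:
  assumes [measurable]: "a \<in> borel_measurable borel"
    and le: "\<And>t. cmod (a t) \<le> inverse (1 + t\<^sup>2)"
  shows "case_sum (\<lambda>s. a (Im s) + of_real \<eta> * \<kappa> (Im s) * a (- Im s)) (\<lambda>i. 0) \<in> H1"
proof (rule H1_I[OF _ _ _ c_pos])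
  let ?f = "\<lambda>t. a t + of_real \<eta> * \<kappa> t * a (- t)"
  have "cmod (?f t) \<le> 2 * inverse (1 + t\<^sup>2)" for t
    using norm_triangle_ineq[of "a t" "of_real \<eta> * \<kappa> t * a (- t)"] le[of t] le[of "-t"]
    by (simp add: norm_mult)
  then show "integrable lborel (\<lambda>t. (c + 1/4 + t\<^sup>2) *
      (cmod (case_sum (\<lambda>s. a (Im s) + of_real \<eta> * \<kappa> (Im s) * a (- Im s)) (\<lambda>i. 0) (Inl (crit t))))\<^sup>2)"
    using integrable_weight_decay[of ?f 2] by simp
qed (auto simp: \<kappa>_minus \<kappa>_def[symmetric] field_simps)

text \<open>The pairing is bilinear while the symmetry of \<open>H1\<close> is twisted by \<open>\<kappa>\<close>, so unfolding the
  symmetrization produces the factor \<open>1 + 1 / \<kappa>\<^sup>2\<close>. It can vanish, but only on a null set.\<close>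

lemma symmetric_orthogonal_imp_zero:
  assumes [measurable]: "g \<in> borel_measurable borel"
    and sym: "AE t in lborel. g (- t) = of_real \<eta> * g t / \<kappa> t"
    and int: "\<And>f. f \<in> H1 \<Longrightarrow> integrable lborel (\<lambda>t. g t * f (Inl (crit t)))"
    and orth: "\<And>f. f \<in> H1 \<Longrightarrow> (\<forall>i. f (Inr i) = 0) \<Longrightarrow> (\<integral>t. g t * f (Inl (crit t)) \<partial>lborel) = 0"
  shows "AE t in lborel. g t = 0"
proof -
  define k where "k t = 1 + 1 / (\<kappa> t)\<^sup>2" for t
  define \<phi> where "\<phi> t = inverse (1 + (cmod (g t))\<^sup>2) * inverse (1 + t\<^sup>2)" for t
  \<comment> \<open>Conjugating \<open>g t * k t\<close> turns the final integrand into a squared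
    modulus; the damping \<open>\<phi>\<close> keeps \<open>a\<close> within the decay bound for
    test functions however fast \<open>g\<close> grows.\<close>
  define a where "a t = cnj (g t * k t) * of_real (\<phi> t)" for t
  have [measurable]: "k \<in> borel_measurable borel" "\<phi> \<in> borel_measurable borel"
    unfolding k_def[abs_def] \<phi>_def[abs_def] by measurable
  have [measurable]: "cnj \<in> borel_measurable borel" "complex_of_real \<in> borel_measurable borel"
    by (intro borel_measurable_continuous_onI continuous_intros)+
  have [measurable]: "a \<in> borel_measurable borel"
    unfolding a_def[abs_def] by measurable
  have k2: "cmod (k t) \<le> 2" for t
    using norm_triangle_ineq[of 1 "1 / (\<kappa> t)\<^sup>2"] by (simp add: k_def norm_divide norm_power)
  have \<phi>0: "\<phi> t > 0" for t
    by (simp add: \<phi>_def add_pos_nonneg)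
  have na: "cmod (a t) = cmod (k t) * (cmod (g t) / (1 + (cmod (g t))\<^sup>2)) * inverse (1 + t\<^sup>2)" for t
    using \<phi>0[of t] by (simp add: a_def norm_mult) (simp add: \<phi>_def divide_inverse mult_ac)
  have inv0: "inverse (1 + t\<^sup>2) \<ge> 0" for t :: real by simp
  have a_le: "cmod (a t) \<le> inverse (1 + t\<^sup>2)" for t
  proof -
    have "cmod (k t) * (cmod (g t) / (1 + (cmod (g t))\<^sup>2)) \<le> 2 * (1/2)"
      using k2 divide_one_plus_square_le(1)[of "cmod (g t)"] by (intro mult_mono) auto
    then show ?thesis
      unfolding na using mult_right_mono[OF _ inv0[of t]] by fastforce
  qed
  let ?b = "\<lambda>t. of_real \<eta> * \<kappa> t * a (- t)"
  have H: "case_sum (\<lambda>s. a (Im s) + of_real \<eta> * \<kappa> (Im s) * a (- Im s)) (\<lambda>i. 0) \<in> H1"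
    by (rule symmetrized_in_H1) (use a_le in auto)
  have I: "integrable lborel (\<lambda>t. g t * (a t + ?b t))" "(\<integral>t. g t * (a t + ?b t) \<partial>lborel) = 0"
    using int[OF H] orth[OF H] by simp_all
  have Ia: "integrable lborel (\<lambda>t. g t * a t)"
  proof (rule Bochner_Integration.integrable_bound)
    show "integrable lborel (\<lambda>t. 2 * inverse (1 + t\<^sup>2) :: real)"
      by (intro integrable_mult_right integrable_inverse_1_plus_sq)
    show "AE t in lborel. cmod (g t * a t) \<le> norm (2 * inverse (1 + t\<^sup>2))"
    proof (rule AE_I2)
      fix t
      have "cmod (g t * a t) = cmod (k t) * ((cmod (g t))\<^sup>2 / (1 + (cmod (g t))\<^sup>2)) * inverse (1 + t\<^sup>2)"
        by (simp add: norm_mult na power2_eq_square)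
      also have "\<dots> \<le> 2 * 1 * inverse (1 + t\<^sup>2)"
        using k2 divide_one_plus_square_le(2)[of "cmod (g t)"] by (intro mult_mono) auto
      finally show "cmod (g t * a t) \<le> norm (2 * inverse (1 + t\<^sup>2))" by simp
    qed
  qed measurable
  have Ib: "integrable lborel (\<lambda>t. g t * ?b t)"
    using Bochner_Integration.integrable_diff[OF I(1) Ia] by (simp add: algebra_simps)
  \<comment> \<open>Substituting \<open>- t\<close> and using the symmetry of \<open>g\<close>
    brings the reflected half back to \<open>g t * a t\<close>, at the cost of dividing by
    \<open>(\<kappa> t)\<^sup>2\<close>.\<close>
  have "(\<integral>t. g t * ?b t \<partial>lborel) = (\<integral>t. g (- t) * ?b (- t) \<partial>lborel)"
    using lborel_integral_real_affine[of "-1" "\<lambda>t. g t * ?b t" 0] by simp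
  also have "\<dots> = (\<integral>t. g t * a t / (\<kappa> t)\<^sup>2 \<partial>lborel)"
  proof (rule integral_cong_AE)
    show "AE t in lborel. g (- t) * ?b (- t) = g t * a t / (\<kappa> t)\<^sup>2"
      using sym
    proof eventually_elim
      case (elim t)
      have "g (- t) * ?b (- t) = (of_real \<eta> * of_real \<eta>) * (g t * a t / (\<kappa> t)\<^sup>2)"
        unfolding elim \<kappa>_minus by (simp add: power2_eq_square field_simps)
      then show ?case by simp
    qed
  qed measurable
  finally have J: "(\<integral>t. g t * ?b t \<partial>lborel) = (\<integral>t. g t * a t / (\<kappa> t)\<^sup>2 \<partial>lborel)" .
  have Ic: "integrable lborel (\<lambda>t. g t * a t / (\<kappa> t)\<^sup>2)"
    by (rule Bochner_Integration.integrable_bound[OF Ia])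
       (measurable, simp add: norm_divide norm_power)
  let ?F = "\<lambda>t. (cmod (g t * k t))\<^sup>2 * \<phi> t"
  \<comment> \<open>The two halves add up to \<open>k t * (g t * a t)\<close>, which is real and
    nonnegative by the choice of \<open>a\<close>; a zero integral therefore forces it to vanish
    almost everywhere.\<close>
  have F: "complex_of_real (?F t) = g t * a t + g t * a t / (\<kappa> t)\<^sup>2" for t
  proof -
    have "complex_of_real (?F t) = (g t * k t) * cnj (g t * k t) * of_real (\<phi> t)"
      by (simp only: of_real_mult complex_norm_square)
    also have "\<dots> = k t * (g t * a t)" by (simp add: a_def mult_ac)
    finally show ?thesis by (simp add: k_def distrib_right)
  qed
  have IF: "integrable lborel ?F"
  proof -
    have "integrable lborel (\<lambda>t. complex_of_real (?F t))"
      unfolding F by (intro Bochner_Integration.integrable_add Ia Ic)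
    then show ?thesis by (simp only: complex_of_real_integrable_eq)
  qed
  have "complex_of_real (\<integral>t. ?F t \<partial>lborel) = (\<integral>t. complex_of_real (?F t) \<partial>lborel)"
    by (simp only: integral_complex_of_real)
  also have "\<dots> = (\<integral>t. g t * a t \<partial>lborel) + (\<integral>t. g t * a t / (\<kappa> t)\<^sup>2 \<partial>lborel)"
    unfolding F by (rule Bochner_Integration.integral_add[OF Ia Ic])
  also have "\<dots> = (\<integral>t. g t * a t + g t * ?b t \<partial>lborel)"
    unfolding J[symmetric] by (rule Bochner_Integration.integral_add[OF Ia Ib, symmetric])
  also have "\<dots> = 0" using I(2) by (simp add: distrib_left)
  finally have "(\<integral>t. ?F t \<partial>lborel) = 0" by simp
  moreover have "AE t in lborel. 0 \<le> ?F t"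
    using \<phi>0 by (simp add: less_imp_le)
  ultimately have "AE t in lborel. ?F t = 0"
    using integral_nonneg_eq_0_iff_AE[OF IF] by blast
  then show ?thesis using \<kappa>_sq_ne
  proof eventually_elim
    case (elim t)
    have "k t \<noteq> 0" using elim(2) by (auto simp: k_def field_simps add_eq_0_iff)
    then show ?case using elim(1) \<phi>0[of t] by simp
  qed
qed

text \<open>Point masses detect the residual at each \<open>\<tau>\<^sub>i\<close>, and test
  functions vanishing at all of these points isolate the integral over the line.\<close>

lemma solves_iff_residual_zero:
  assumes u: "u \<in> H1"
  shows "solves h n \<sigma> \<eta> c (crit a) u \<longleftrightarrow>
    (AE t in lborel. residual a u (Inl (crit t)) = 0) \<and> (\<forall>i\<in>{1..n}. residual a u (Inr i) = 0)"
    (is "_ \<longleftrightarrow> ?L \<and> ?S")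
proof
  assume "solves h n \<sigma> \<eta> c (crit a) u"
  then have eq: "(\<integral>t. residual a u (Inl (crit t)) * f (Inl (crit t)) \<partial>lborel) / of_real (4 * pi)
         + (\<Sum>i = 1..n. residual a u (Inr i) * f (Inr i)) = 0" if "f \<in> H1" for f
    using that solves_iff[OF u] by blast
  have "residual a u (Inr i) = 0" if "i \<in> {1..n}" for i
    using eq[OF delta_in_H1, of i] that by (simp add: if_distrib sum.delta cong: if_cong)
  moreover have ?L
  proof (rule symmetric_orthogonal_imp_zero)
    fix f assume "f \<in> H1" "\<forall>i. f (Inr i) = 0"
    then show "(\<integral>t. residual a u (Inl (crit t)) * f (Inl (crit t)) \<partial>lborel) = 0"
      using eq[of f] by simp
  qed (use residual_measurable residual_symmetric residual_integrable u in auto)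
  ultimately show "?L \<and> ?S" by blast
next
  assume R: "?L \<and> ?S"
  have "(\<integral>t. residual a u (Inl (crit t)) * f (Inl (crit t)) \<partial>lborel) = 0"
    for f :: "point \<Rightarrow> complex"
  proof -
    have "AE t in lborel. residual a u (Inl (crit t)) * f (Inl (crit t)) = 0"
      using R[THEN conjunct1] by eventually_elim simp
    then show ?thesis by (rule integral_eq_zero_AE)
  qed
  then show "solves h n \<sigma> \<eta> c (crit a) u"
    unfolding solves_iff[OF u] using R by simp
qed

section \<open>Vanishing of \<open>\<Theta>\<close> at the spectral parameter\<close>

text \<open>If \<open>\<Theta> a\<close> were nonzero, \<open>u\<close> would grow at least like the
  inverse distance to \<open>a\<close>. A window of length \<open>e\<close> at distance
  \<open>e\<close> from \<open>a\<close> would then contribute at least \<open>A / e\<close> to the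
  finite weighted integral, which is unbounded as \<open>e\<close> tends to 0.\<close>

lemma zero_of_solution:
  assumes u: "u \<in> H1" and ae: "AE t in lborel. of_real (a\<^sup>2 - t\<^sup>2) * u (Inl (crit t)) = \<Theta> t"
  shows "\<Theta> a = 0"
proof (rule ccontr)
  assume "\<Theta> a \<noteq> 0"
  define \<delta> where "\<delta> = cmod (\<Theta> a) / 2"
  have \<delta>: "\<delta> > 0" using \<open>\<Theta> a \<noteq> 0\<close> by (simp add: \<delta>_def)
  obtain r where r: "r > 0" "\<And>t. \<bar>t - a\<bar> < r \<Longrightarrow> cmod (\<Theta> t - \<Theta> a) < \<delta>"
    using isCont_\<Theta>[of a] \<delta> unfolding continuous_at_eps_delta by (auto simp: dist_norm)
  have big: "cmod (\<Theta> t) \<ge> \<delta>" if "\<bar>t - a\<bar> < r" for t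
    using r(2)[OF that] norm_triangle_ineq2[of "\<Theta> a" "\<Theta> t"]
    by (simp add: \<delta>_def norm_minus_commute)
  \<comment> \<open>A bound for \<open>\<bar>t + a\<bar>\<close> when \<open>t\<close> is within
    distance 1 of \<open>a\<close>.\<close>
  define M where "M = 2 * \<bar>a\<bar> + 1"
  have M: "M > 0" by (simp add: M_def)
  let ?F = "\<lambda>t. (c + 1/4 + t\<^sup>2) * (cmod (u (Inl (crit t))))\<^sup>2"
  define I where "I = (\<integral>t. ?F t \<partial>lborel)"
  have IF: "integrable lborel ?F" by (rule H1_line(2)[OF u c_pos])
  \<comment> \<open>On the window the weight is at least \<open>c\<close> and the modulus of
    \<open>u\<close> at least \<open>\<delta> / (2 * M) / e\<close>, so the integrand is at least
    \<open>A / e\<^sup>2\<close>.\<close>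
  define A where "A = c * (\<delta> / (2 * M))\<^sup>2"
  have A: "A > 0" using c_pos \<delta> M by (simp add: A_def)
  have bound: "A / e \<le> I" if e: "0 < e" "2 * e < r" "2 * e \<le> 1" for e
  proof -
    let ?J = "{a + e..a + 2 * e}"
    have "(\<integral>t. A / e\<^sup>2 * indicator ?J t \<partial>lborel) \<le> I"
      unfolding I_def
    proof (rule integral_mono_AE)
      show "integrable lborel (\<lambda>t. A / e\<^sup>2 * indicator ?J t)"
        using e by (intro integrable_mult_right integrable_real_indicator) auto
      show "AE t in lborel. A / e\<^sup>2 * indicator ?J t \<le> ?F t"
        using ae
      proof eventually_elim
        case (elim t)
        show ?case
        proof (cases "t \<in> ?J")
          case False
          then show ?thesis using c_pos by simp
        next
          case True
          then have t: "e \<le> t - a" "t - a \<le> 2 * e" by auto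
          let ?x = "cmod (u (Inl (crit t)))"
          have "\<delta> \<le> cmod (\<Theta> t)" using t e by (intro big) auto
          also have "\<dots> = \<bar>a\<^sup>2 - t\<^sup>2\<bar> * ?x"
            unfolding elim[symmetric] by (simp only: norm_mult norm_of_real)
          also have "\<bar>a\<^sup>2 - t\<^sup>2\<bar> = \<bar>t - a\<bar> * \<bar>t + a\<bar>"
            by (simp add: abs_mult[symmetric] power2_eq_square algebra_simps abs_minus_commute)
          also have "\<dots> * ?x \<le> (2 * e * M) * ?x"
            using t e by (intro mult_right_mono mult_mono) (auto simp: M_def)
          finally have "\<delta> / (2 * M) / e \<le> ?x"
            using e M by (simp add: field_simps)
          then have "(\<delta> / (2 * M) / e)\<^sup>2 \<le> ?x\<^sup>2"
            using \<delta> M e by (intro power_mono) auto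
          then have "c * (\<delta> / (2 * M) / e)\<^sup>2 \<le> (c + 1/4 + t\<^sup>2) * ?x\<^sup>2"
            using c_pos by (intro mult_mono) auto
          then show ?thesis using True by (simp add: A_def power_divide power_mult_distrib)
        qed
      qed
    qed (rule IF)
    moreover have "(\<integral>t. A / e\<^sup>2 * indicator ?J t \<partial>lborel) = A / e\<^sup>2 * e"
      using e by simp
    ultimately show ?thesis using e by (simp add: power2_eq_square)
  qed
  \<comment> \<open>The first two bounds keep the window in the range where \<open>\<Theta>\<close>
    and \<open>t + a\<close> are controlled; the third makes \<open>A / e\<close> at least
    \<open>\<bar>I\<bar> + 1\<close>.\<close>
  define e where "e = min (min (r / 3) (1/2)) (A / (\<bar>I\<bar> + 1))"
  have e_le: "e \<le> r / 3" "e \<le> 1/2" and e4: "e \<le> A / (\<bar>I\<bar> + 1)"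
    unfolding e_def by linarith+
  have e0: "0 < e"
    using r(1) A by (simp add: e_def add_nonneg_pos)
  have e: "0 < e" "2 * e < r" "2 * e \<le> 1" "e \<le> A / (\<bar>I\<bar> + 1)"
    using e_le e4 e0 r(1) by linarith+
  have "e * (\<bar>I\<bar> + 1) \<le> A"
    using e(4) by (simp add: le_divide_eq split: if_splits)
  then have "\<bar>I\<bar> + 1 \<le> A / e" using e(1) by (simp add: le_divide_eq mult.commute)
  then show False using bound[OF e(1-3)] by linarith
qed

section \<open>The explicit solution: decay, membership and uniqueness\<close>

text \<open>The modulus is even in \<open>t\<close>, and for \<open>t \<ge> 0\<close> the
  denominator vanishes only at \<open>\<bar>a\<bar>\<close>. Near that point the zero of
  \<open>\<Theta>\<close> cancels it; farther away \<open>\<Theta>\<close> is bounded and the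
  denominator is at least the squared distance to \<open>\<bar>a\<bar>\<close>.\<close>

lemma quotient_decay:
  assumes z: "\<Theta> a = 0"
    and d: "a = 0 \<Longrightarrow> deriv (\<lambda>s. theta h \<sigma> \<eta> (Inl s)) (crit 0) = 0"
  shows "\<exists>K. \<forall>t. cmod (\<Theta> t / of_real (a\<^sup>2 - t\<^sup>2)) \<le> K * inverse (1 + t\<^sup>2)"
proof -
  define b where "b = \<bar>a\<bar>"
  have b: "b \<ge> 0" "b\<^sup>2 = a\<^sup>2" by (auto simp: b_def)
  have zb: "\<Theta> b = 0"
    using z norm_\<Theta>_minus[of a] unfolding b_def abs_if by (auto simp: z)
  let ?f = "\<lambda>s. theta h \<sigma> \<eta> (Inl s)"
  have an: "?f analytic_on {crit b}"
    unfolding theta_def using analytic_crit[of b] by (auto intro!: analytic_intros)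
  have fz: "?f (crit b) = 0" using zb by (simp add: theta_crit)
  \<comment> \<open>The denominator vanishes to first order at \<open>b \<noteq> 0\<close> but to second order at \<open>b = 0\<close>.\<close>
  have near: "\<exists>r>0. \<exists>L\<ge>0. \<forall>t\<ge>0. \<bar>t - b\<bar> < r \<longrightarrow> cmod (\<Theta> t) \<le> L * \<bar>a\<^sup>2 - t\<^sup>2\<bar>"
  proof (cases "b = 0")
    case True
    then have "deriv ?f (crit b) = 0" using d by (simp add: b_def)
    then obtain r L where rL: "r > 0" "L \<ge> 0"
      "\<And>s. dist (crit b) s < r \<Longrightarrow> cmod (?f s) \<le> L * (cmod (s - crit b))\<^sup>2"
      using analytic_zero_bound(2)[OF an fz] by blast
    have "cmod (\<Theta> t) \<le> L * \<bar>a\<^sup>2 - t\<^sup>2\<bar>" if "\<bar>t - b\<bar> < r" for t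
      using rL(3)[of "crit t"] that True b(2)
      by (simp add: theta_crit dist_norm crit_diff abs_minus_commute)
    then show ?thesis using rL by blast
  next
    case False
    obtain r L where rL: "r > 0" "L \<ge> 0"
      "\<And>s. dist (crit b) s < r \<Longrightarrow> cmod (?f s) \<le> L * cmod (s - crit b)"
      using analytic_zero_bound(1)[OF an fz] by blast
    have "cmod (\<Theta> t) \<le> L / b * \<bar>a\<^sup>2 - t\<^sup>2\<bar>" if t: "t \<ge> 0" "\<bar>t - b\<bar> < r" for t
    proof -
      have "cmod (\<Theta> t) \<le> L * \<bar>t - b\<bar>"
        using rL(3)[of "crit t"] t
        by (simp add: theta_crit dist_norm crit_diff abs_minus_commute)
      also have "\<dots> = L / b * (\<bar>t - b\<bar> * b)" using False by simp
      also have "\<dots> \<le> L / b * (\<bar>t - b\<bar> * \<bar>t + b\<bar>)"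
        using rL b t by (intro mult_left_mono) auto
      also have "\<bar>t - b\<bar> * \<bar>t + b\<bar> = \<bar>a\<^sup>2 - t\<^sup>2\<bar>"
        unfolding b(2)[symmetric]
        by (simp add: abs_mult[symmetric] power2_eq_square algebra_simps abs_minus_commute)
      finally show ?thesis .
    qed
    then show ?thesis using rL b by (intro exI[of _ r] conjI exI[of _ "L / b"]) auto
  qed
  then obtain r L where r: "r > 0" and L: "L \<ge> 0"
    and rL: "\<And>t. t \<ge> 0 \<Longrightarrow> \<bar>t - b\<bar> < r \<Longrightarrow> cmod (\<Theta> t) \<le> L * \<bar>a\<^sup>2 - t\<^sup>2\<bar>" by blast
  \<comment> \<open>Chosen so that \<open>1 + t\<^sup>2 \<le> M * (t - b)\<^sup>2\<close> once
    \<open>t\<close> is at distance at least \<open>r\<close> from \<open>b\<close>, by way of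
    \<open>t\<^sup>2 \<le> 2 * b\<^sup>2 + 2 * (t - b)\<^sup>2\<close>. The constant
    \<open>K\<close> adds the bounds of the two ranges.\<close>
  define M where "M = (1 + 2 * b\<^sup>2) / r\<^sup>2 + 2"
  define K where "K = L * (1 + (b + r)\<^sup>2) + 2 * M"
  have M: "M > 0" using r by (simp add: M_def add_nonneg_pos)
  have pos: "cmod (\<Theta> t / of_real (a\<^sup>2 - t\<^sup>2)) * (1 + t\<^sup>2) \<le> K" if t: "t \<ge> 0" for t
  proof (cases "\<bar>t - b\<bar> < r")
    case True
    have "cmod (\<Theta> t / of_real (a\<^sup>2 - t\<^sup>2)) = cmod (\<Theta> t) / \<bar>a\<^sup>2 - t\<^sup>2\<bar>"
      by (simp only: norm_divide norm_of_real)
    \<comment> \<open>At \<open>t = b\<close> the denominator is 0 and division by it gives 0, which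
      \<open>L \<ge> 0\<close> covers.\<close>
    also have "\<dots> \<le> L"
      using rL[OF t True] L by (cases "a\<^sup>2 - t\<^sup>2 = 0") (simp_all add: divide_le_eq)
    finally have q: "cmod (\<Theta> t / of_real (a\<^sup>2 - t\<^sup>2)) \<le> L" .
    have "t\<^sup>2 \<le> (b + r)\<^sup>2" using t True by (intro power_mono) auto
    then have "cmod (\<Theta> t / of_real (a\<^sup>2 - t\<^sup>2)) * (1 + t\<^sup>2) \<le> L * (1 + (b + r)\<^sup>2)"
      using q L by (intro mult_mono) auto
    then show ?thesis using M by (simp add: K_def)
  next
    case False
    let ?d = "\<bar>t - b\<bar>"
    have d: "?d \<ge> r" "?d > 0" using False r by auto
    have "?d * ?d \<le> ?d * \<bar>t + b\<bar>" using t b by (intro mult_left_mono) auto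
    also have "\<dots> = \<bar>a\<^sup>2 - t\<^sup>2\<bar>"
      unfolding b(2)[symmetric]
      by (simp add: abs_mult[symmetric] power2_eq_square algebra_simps abs_minus_commute)
    finally have den: "?d\<^sup>2 \<le> \<bar>a\<^sup>2 - t\<^sup>2\<bar>" by (simp add: power2_eq_square)
    have "r\<^sup>2 \<le> ?d\<^sup>2" using d r by (intro power_mono) auto
    then have "(1 + 2 * b\<^sup>2) / r\<^sup>2 * r\<^sup>2 \<le> (1 + 2 * b\<^sup>2) / r\<^sup>2 * ?d\<^sup>2"
      using r by (intro mult_left_mono) (auto intro!: divide_nonneg_nonneg)
    moreover have "(1 + 2 * b\<^sup>2) / r\<^sup>2 * r\<^sup>2 = 1 + 2 * b\<^sup>2" using r by simp
    ultimately have "1 + 2 * b\<^sup>2 + 2 * ?d\<^sup>2 \<le> M * ?d\<^sup>2"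
      unfolding M_def distrib_right by linarith
    moreover have "t\<^sup>2 \<le> 2 * b\<^sup>2 + 2 * ?d\<^sup>2"
      using zero_le_power2[of "t - 2 * b"] by (simp add: power2_eq_square algebra_simps)
    ultimately have "1 + t\<^sup>2 \<le> M * ?d\<^sup>2" by linarith
    also have "\<dots> \<le> M * \<bar>a\<^sup>2 - t\<^sup>2\<bar>" using den M by (intro mult_left_mono) auto
    finally have 1: "1 + t\<^sup>2 \<le> M * \<bar>a\<^sup>2 - t\<^sup>2\<bar>" .
    have D: "\<bar>a\<^sup>2 - t\<^sup>2\<bar> > 0" using den d by (smt (verit) zero_less_power)
    have "cmod (\<Theta> t / of_real (a\<^sup>2 - t\<^sup>2)) * (1 + t\<^sup>2) = cmod (\<Theta> t) * (1 + t\<^sup>2) / \<bar>a\<^sup>2 - t\<^sup>2\<bar>"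
      by (simp only: norm_divide norm_of_real times_divide_eq_left)
    also have "\<dots> \<le> 2 * (M * \<bar>a\<^sup>2 - t\<^sup>2\<bar>) / \<bar>a\<^sup>2 - t\<^sup>2\<bar>"
      using 1 norm_\<Theta>_le[of t] by (intro divide_right_mono mult_mono) auto
    also have "\<dots> = 2 * M" using D by simp
    finally show ?thesis using L by (simp add: K_def add_increasing)
  qed
  have "cmod (\<Theta> t / of_real (a\<^sup>2 - t\<^sup>2)) \<le> K * inverse (1 + t\<^sup>2)" for t
  proof -
    have "cmod (\<Theta> t / of_real (a\<^sup>2 - t\<^sup>2)) = cmod (\<Theta> \<bar>t\<bar> / of_real (a\<^sup>2 - \<bar>t\<bar>\<^sup>2))"
      by (simp add: norm_divide abs_if norm_\<Theta>_minus)
    then have "cmod (\<Theta> t / of_real (a\<^sup>2 - t\<^sup>2)) * (1 + t\<^sup>2) \<le> K"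
      using pos[of "\<bar>t\<bar>"] by simp
    moreover have "1 + t\<^sup>2 > 0" by (simp add: add_pos_nonneg)
    ultimately show ?thesis by (simp add: field_simps)
  qed
  then show ?thesis by blast
qed

lemma u_sol_crit: "u_sol h \<sigma> \<eta> (crit a) (Inl (crit t)) = \<Theta> t / of_real (a\<^sup>2 - t\<^sup>2)"
  by (simp add: u_sol_def lam_crit \<Theta>_def \<kappa>_def)

lemma u_sol_in_H1:
  assumes "\<Theta> a = 0" and "a = 0 \<Longrightarrow> deriv (\<lambda>s. theta h \<sigma> \<eta> (Inl s)) (crit 0) = 0"
  shows "u_sol h \<sigma> \<eta> (crit a) \<in> H1"
proof (rule H1_I[OF _ _ _ c_pos], unfold u_sol_crit)
  show m: "(\<lambda>t. \<Theta> t / of_real (a\<^sup>2 - t\<^sup>2)) \<in> borel_measurable borel" by measurable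
  show "integrable lborel (\<lambda>t. (c + 1/4 + t\<^sup>2) * (cmod (\<Theta> t / of_real (a\<^sup>2 - t\<^sup>2)))\<^sup>2)"
    using quotient_decay[OF assms] integrable_weight_decay[OF m] by blast
  show "AE t in lborel. \<Theta> (- t) / of_real (a\<^sup>2 - (- t)\<^sup>2)
      = of_real \<eta> * (\<Theta> t / of_real (a\<^sup>2 - t\<^sup>2)) / c_fun h (crit t)"
    by (simp add: \<Theta>_minus \<kappa>_def)
qed

text \<open>Completing the square puts \<open>\<sigma> i * (\<sigma> i - 1)\<close> strictly above
  \<open>- 1/4\<close>, whereas \<open>lam\<close> is at most \<open>- 1/4\<close> on the
  line.\<close>

lemma lam_at_Inr_ne:
  assumes "\<sigma> i > 1/2"
  shows "lam_at \<sigma> (Inr i) - lam (crit a) \<noteq> 0"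
proof -
  have "0 < (\<sigma> i - 1/2)\<^sup>2" using assms by simp
  also have "(\<sigma> i - 1/2)\<^sup>2 = \<sigma> i * (\<sigma> i - 1) + 1/4"
    by (simp add: power2_eq_square algebra_simps)
  finally have "0 < \<sigma> i * (\<sigma> i - 1) + 1/4 + a\<^sup>2"
    using zero_le_power2[of a] by linarith
  moreover have "lam_at \<sigma> (Inr i) - lam (crit a) = of_real (\<sigma> i * (\<sigma> i - 1) + 1/4 + a\<^sup>2)"
    unfolding lam_crit by (simp add: lam_at_def lam_def)
  ultimately show ?thesis by (metis less_irrefl of_real_eq_0_iff)
qed

lemma AE_sq_ne: "AE t in lborel. a\<^sup>2 - t\<^sup>2 \<noteq> (0::real)"
proof -
  have "{t::real. a\<^sup>2 - t\<^sup>2 = 0} \<subseteq> {a, - a}" by (auto simp: power2_eq_iff)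
  then have "countable {t::real. a\<^sup>2 - t\<^sup>2 = 0}" using countable_finite finite_subset by blast
  then have "{t::real. a\<^sup>2 - t\<^sup>2 = 0} \<in> null_sets lborel"
    by (rule countable_imp_null_set_lborel)
  then show ?thesis by (rule AE_I') auto
qed

text \<open>The factor multiplying \<open>u\<close> in the residual can be divided out: on the line
  it vanishes at most at \<open>t = a\<close> and \<open>t = - a\<close>, a null set, and at the
  \<open>\<tau>\<^sub>i\<close> it never vanishes.\<close>

lemma residual_zero_iff_eq_u_sol:
  assumes \<sigma>: "\<And>i. i \<in> {1..n} \<Longrightarrow> \<sigma> i > 1/2"
  shows "(AE t in lborel. residual a u (Inl (crit t)) = 0) \<and> (\<forall>i\<in>{1..n}. residual a u (Inr i) = 0)
    \<longleftrightarrow> eq_H n u (u_sol h \<sigma> \<eta> (crit a))"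
proof -
  have eq: "AE t in lborel. residual a u (Inl (crit t)) = 0 \<longleftrightarrow>
      u (Inl (crit t)) = u_sol h \<sigma> \<eta> (crit a) (Inl (crit t))"
    using AE_sq_ne[of a]
  proof eventually_elim
    case (elim t)
    then have "complex_of_real (a\<^sup>2 - t\<^sup>2) \<noteq> 0" by (simp only: of_real_eq_0_iff not_False_eq_True)
    then show ?case
      by (simp add: residual_crit u_sol_crit eq_divide_eq mult.commute del: of_real_diff of_real_power)
  qed
  have "(AE t in lborel. residual a u (Inl (crit t)) = 0) \<longleftrightarrow>
      (AE t in lborel. u (Inl (crit t)) = u_sol h \<sigma> \<eta> (crit a) (Inl (crit t)))"
    using eq by (intro iffI) (elim AE_mp, auto elim: AE_mp)+
  moreover have "residual a u (Inr i) = 0 \<longleftrightarrow> u (Inr i) = u_sol h \<sigma> \<eta> (crit a) (Inr i)"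
    if "i \<in> {1..n}" for i
    using lam_at_Inr_ne[OF \<sigma>[OF that], of a]
    by (simp add: residual_def u_sol_def theta_def lam_at_def eq_divide_eq mult.commute)
  ultimately show ?thesis unfolding eq_H_def by blast
qed

end

text \<open>At \<open>w = 1/2\<close> the denominator \<open>lam s - lam w\<close> is
  \<open>(s - 1/2)\<^sup>2\<close>, so a simple zero of \<open>theta\<close> would leave a
  first-order singularity, which is not square-integrable; hence the derivative condition there.
  Elements of the space are representatives, so uniqueness is up to \<open>eq_H\<close>.\<close>

theorem theorem11:
  fixes h :: "complex \<Rightarrow> complex" and n :: nat and \<sigma> :: "nat \<Rightarrow> real"
    and \<epsilon> \<eta> c :: real and w :: complex
  assumes "h nicely_meromorphic_on UNIV"
    and "zeros_right h = (\<lambda>i. of_real (\<sigma> i)) ` {1..n}"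
    and "strict_mono_on {1..n} \<sigma>"
    and "\<forall>x::real. h (of_real x) \<in> \<real>"
    and "\<epsilon> > 0" and "c_growth h \<epsilon>"
    and "\<eta> \<in> {1, -1}"
    and "\<forall>i\<in>{1..n}. of_real \<eta> * Res_c h \<sigma> i \<in> \<real>\<^sub>\<ge>\<^sub>0"
    and "\<not> L2_crit (\<lambda>s. 1 + of_real \<eta> * c_fun h s)"
    and "c > 0"
    and "Re w = 1/2"
  shows "((\<exists>u\<in>H_space h \<sigma> \<eta> c 1. solves h n \<sigma> \<eta> c w u) \<longrightarrow> theta h \<sigma> \<eta> (Inl w) = 0) \<and>
         (theta h \<sigma> \<eta> (Inl w) = 0 \<and> (w = 1/2 \<longrightarrow> deriv (\<lambda>s. theta h \<sigma> \<eta> (Inl s)) w = 0) \<longrightarrow>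
            u_sol h \<sigma> \<eta> w \<in> H_space h \<sigma> \<eta> c 1 \<and>
            solves h n \<sigma> \<eta> c w (u_sol h \<sigma> \<eta> w) \<and>
            (\<forall>u\<in>H_space h \<sigma> \<eta> c 1. solves h n \<sigma> \<eta> c w u \<longrightarrow> eq_H n u (u_sol h \<sigma> \<eta> w)))"
proof -
  \<comment> \<open>For the zero function every positive integer would lie in
    \<open>zeros_right h\<close>, which is finite.\<close>
  have "\<exists>s. h s \<noteq> 0"
  proof (rule ccontr)
    assume "\<nexists>s. h s \<noteq> 0"
    then have h0: "h = (\<lambda>_. 0)" by auto
    have "\<not> is_pole (\<lambda>_. 0::complex) s" for s :: complex
      by (rule not_is_pole_holomorphic[of UNIV]) auto
    then have "zeros_right h = {s. Re s > 1/2}" by (auto simp: zeros_right_def h0)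
    then have fin: "finite {s. Re s > 1/2}" using assms(2) by (metis finite_atLeastAtMost finite_imageI)
    have "of_nat ` {1..} \<subseteq> {s. Re s > 1/2}" by auto
    then have "finite (of_nat ` {1..} :: complex set)" using fin finite_subset by blast
    then have "finite {1::nat..}" by (rule finite_imageD) (simp add: inj_on_def)
    then show False using infinite_Ici by blast
  qed
  then interpret critical_line h \<sigma> \<eta> c
    using assms by unfold_locales auto
  obtain a where w: "w = crit a"
    using assms(11) by (metis crit_def complex.collapse)
  have \<sigma>: "\<sigma> i > 1/2" if "i \<in> {1..n}" for i
  proof -
    have "of_real (\<sigma> i) \<in> zeros_right h" using assms(2) that by auto
    then show ?thesis by (simp add: zeros_right_def)
  qed
  \<comment> \<open>Within \<open>H1\<close>, solving the equation means agreeing with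
    \<open>u_sol\<close>. What remains is that a solution forces \<open>\<Theta> a = 0\<close>, and
    that \<open>u_sol\<close> itself belongs to \<open>H1\<close>.\<close>
  have sol: "solves h n \<sigma> \<eta> c (crit a) u \<longleftrightarrow> eq_H n u (u_sol h \<sigma> \<eta> (crit a))" if "u \<in> H1" for u
    using solves_iff_residual_zero[OF that] residual_zero_iff_eq_u_sol[OF \<sigma>] by blast
  have "\<Theta> a = 0" if "u \<in> H1" "solves h n \<sigma> \<eta> c (crit a) u" for u
  proof (rule zero_of_solution[OF that(1)])
    have "AE t in lborel. residual a u (Inl (crit t)) = 0"
      using that solves_iff_residual_zero by blast
    then show "AE t in lborel. of_real (a\<^sup>2 - t\<^sup>2) * u (Inl (crit t)) = \<Theta> t"
      by eventually_elim (simp add: residual_crit)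
  qed
  moreover have "u_sol h \<sigma> \<eta> (crit a) \<in> H1"
    if "\<Theta> a = 0" "crit a = 1/2 \<longrightarrow> deriv (\<lambda>s. theta h \<sigma> \<eta> (Inl s)) (crit a) = 0"
  proof (rule u_sol_in_H1[OF that(1)])
    assume "a = 0"
    moreover have "crit 0 = 1/2" by (simp add: crit_def complex_eq_iff)
    ultimately show "deriv (\<lambda>s. theta h \<sigma> \<eta> (Inl s)) (crit 0) = 0" using that(2) by simp
  qed
  moreover have "eq_H n u u" for u by (simp add: eq_H_def)
  ultimately show ?thesis
    unfolding w theta_crit using sol by blast
qed

end
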